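(* Let $P$ be a nonempty set of primes and let $F$ be a free group. Let $w \in F\setminus\{1\}$, $u = \mathrm{root}(w)$ and $e = \mathrm{exp}(w)$. Then: (i) $\mathrm{Cl}_{\mathbf{G}_P}(\langle 1\rangle) = \langle 1\rangle$; (ii) $\langle w\rangle$ is $\mathbf{G}_P$-closed if and only if $e$ is a product of primes in $P$, if and only if the implication $v^p \in \langle w\rangle \Rightarrow v \in \langle w\rangle$ holds for all $v \in F$ and all $p \in P^{\perp}$; (iii) $\mathrm{Cl}_{\mathbf{G}_P}(\langle w\rangle) = \langle u^{\nu_P(e)}\rangle$.
   Context: $\mathbf{G}_P$ denotes the class (pseudovariety) of all finite groups whose order is a product of primes in $P$ (repetitions allowed; the empty product $1$ is allowed). $P^{\perp}$ is the set of all primes not in $P$. For $k \geq 1$, $\nu_P(k)$ is the largest divisor of $k$ which is a product (possibly empty) of primes in $P$. For a pseudovariety $\mathbf{V}$ of finite groups, the pro-$\mathbf{V}$ topology on a group $G$ is the coarsest topology making all homomorphisms from $G$ into (discrete) members of $\mathbf{V}$ continuous; equivalently, $G$ is a topological group in which the normal subgroups $K$ with $G/K \in \mathbf{V}$ form a basis of neighbourhoods of the identity. "$\mathbf{V}$-closed" means closed in the pro-$\mathbf{V}$ topology, and $\mathrm{Cl}_{\mathbf{V}}(S)$ denotes the closure of $S \subseteq F$ in the pro-$\mathbf{V}$ topology on $F$. For $w \in F \setminus\{1\}$, the exponent $\mathrm{exp}(w)$ is the maximum $r \geq 1$ such that $w = v^r$ for some $v \in F$, and $\mathrm{root}(w)$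 is the (unique) element of $F$ with $w = \mathrm{root}(w)^{\mathrm{exp}(w)}$. *)

theory Defs
  imports "HOL-Algebra.Generated_Groups" "HOL-Analysis.Abstract_Topology"
    "HOL-Computational_Algebra.Primes"
begin

section \<open>Free groups\<close>

text \<open>A letter \<open>(True, x)\<close> stands for the generator \<open>x\<close> and \<open>(False, x)\<close> for its
  formal inverse. The free group on \<open>X\<close> consists of the reduced words over these letters, multiplied
  by concatenation followed by free reduction.\<close>

type_synonym 'x letter = "bool \<times> 'x"

definition flip :: "'x letter \<Rightarrow> 'x letter" where
  "flip a = (\<not> fst a, snd a)"

definition reduced :: "'x letter list \<Rightarrow> bool" where
  "reduced w \<longleftrightarrow> successively (\<lambda>a b. b \<noteq> flip a) w"

fun push :: "'x letter \<Rightarrow> 'x letter list \<Rightarrow> 'x letter list" where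
  "push a [] = [a]"
| "push a (b # w) = (if b = flip a then w else a # b # w)"

definition free_group :: "'x set \<Rightarrow> 'x letter list monoid" where
  "free_group X =
     \<lparr>carrier = {w. reduced w \<and> snd ` set w \<subseteq> X}, monoid.mult = (\<lambda>v w. foldr push v w), one = []\<rparr>"

text \<open>Taking the basis in the carrier type of \<open>F\<close> is no restriction, since a basis of a free
  group embeds into it.\<close>

definition is_free_group :: "('a, 'b) monoid_scheme \<Rightarrow> bool" where
  "is_free_group F \<longleftrightarrow> group F \<and> (\<exists>X :: 'a set. F \<cong> free_group X)"

lemma flip_flip [simp]: "flip (flip a) = a"
  by (simp add: flip_def)

lemma flip_neq [simp]: "flip a \<noteq> a" "a \<noteq> flip a"
  by (auto simp: flip_def prod_eq_iff)

lemma snd_flip [simp]: "snd (flip a) = snd a"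
  by (simp add: flip_def)

lemma reduced_push: "reduced w \<Longrightarrow> reduced (push a w)"
  by (cases w) (auto simp: reduced_def successively_Cons)

lemma push_flip: "reduced w \<Longrightarrow> push a (push (flip a) w) = w"
  by (cases w rule: remdups_adj.cases) (auto simp: reduced_def)

lemma reduced_foldr_push: "reduced w \<Longrightarrow> reduced (foldr push v w)"
  by (induction v) (auto simp: reduced_push)

lemma set_push: "set (push a w) \<subseteq> insert a (set w)"
  by (cases w) auto

lemma set_foldr_push: "set (foldr push v w) \<subseteq> set v \<union> set w"
  by (induction v) (use set_push in fastforce)+

lemma foldr_push_push:
  "reduced w \<Longrightarrow> foldr push (push a v) w = push a (foldr push v w)"
  by (cases v) (auto simp: push_flip reduced_foldr_push)

lemma foldr_push_foldr_push:
  "reduced w \<Longrightarrow> foldr push (foldr push u v) w = foldr push u (foldr push v w)"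
  by (induction u) (auto simp: foldr_push_push)

lemma foldr_push_Nil: "reduced v \<Longrightarrow> foldr push v [] = v"
proof (induction v)
  case (Cons a v)
  then show ?case by (cases v) (auto simp: reduced_def)
qed simp

lemma foldr_push_inverse: "foldr push (rev (map flip v)) v = []"
proof (induction v)
  case (Cons a v)
  then show ?case by simp
qed simp

lemma reduced_inverse: "reduced v \<Longrightarrow> reduced (rev (map flip v))"
  unfolding reduced_def successively_rev successively_map
  by (erule successively_mono) (metis flip_flip)

lemma group_free_group: "group (free_group X)"
proof (rule groupI)
  fix v assume v: "v \<in> carrier (free_group X)"
  show "\<exists>u\<in>carrier (free_group X). u \<otimes>\<^bsub>free_group X\<^esub> v = \<one>\<^bsub>free_group X\<^esub>"
    by (rule bexI[of _ "rev (map flip v)"])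
      (use v in \<open>auto simp: free_group_def foldr_push_inverse reduced_inverse\<close>)
next
  fix v w assume "v \<in> carrier (free_group X)" "w \<in> carrier (free_group X)"
  then show "v \<otimes>\<^bsub>free_group X\<^esub> w \<in> carrier (free_group X)"
    using set_foldr_push[of v w] by (force simp: free_group_def reduced_foldr_push)
qed (auto simp: free_group_def foldr_push_foldr_push, auto simp: reduced_def)

definition letter_val :: "('g, 'c) monoid_scheme \<Rightarrow> ('x \<Rightarrow> 'g) \<Rightarrow> 'x letter \<Rightarrow> 'g" where
  "letter_val G f a = (if fst a then f (snd a) else inv\<^bsub>G\<^esub> f (snd a))"

definition word_val :: "('g, 'c) monoid_scheme \<Rightarrow> ('x \<Rightarrow> 'g) \<Rightarrow> 'x letter list \<Rightarrow> 'g" where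
  "word_val G f w = foldr (\<lambda>a g. letter_val G f a \<otimes>\<^bsub>G\<^esub> g) w \<one>\<^bsub>G\<^esub>"

context group
begin

lemma letter_val_closed: "f \<in> X \<rightarrow> carrier G \<Longrightarrow> snd a \<in> X \<Longrightarrow> letter_val G f a \<in> carrier G"
  by (auto simp: letter_val_def)

lemma letter_val_flip:
  "f \<in> X \<rightarrow> carrier G \<Longrightarrow> snd a \<in> X \<Longrightarrow> letter_val G f (flip a) = inv (letter_val G f a)"
  by (auto simp: letter_val_def flip_def dest: funcset_mem)

lemma word_val_closed:
  "f \<in> X \<rightarrow> carrier G \<Longrightarrow> snd ` set w \<subseteq> X \<Longrightarrow> word_val G f w \<in> carrier G"
proof (induction w)
  case (Cons a w)
  then show ?case using letter_val_closed[of f X a] by (simp add: word_val_def)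
qed (simp add: word_val_def)

lemma word_val_Cons: "word_val G f (a # w) = letter_val G f a \<otimes> word_val G f w"
  by (simp add: word_val_def)

lemma word_val_push:
  assumes f: "f \<in> X \<rightarrow> carrier G" and a: "snd a \<in> X" and w: "snd ` set w \<subseteq> X"
  shows "word_val G f (push a w) = letter_val G f a \<otimes> word_val G f w"
proof (cases w)
  case (Cons b v)
  have "word_val G f v \<in> carrier G" "letter_val G f a \<in> carrier G"
    using assms Cons by (auto intro: word_val_closed letter_val_closed)
  then show ?thesis
    using Cons f a by (auto simp: word_val_Cons letter_val_flip m_assoc[symmetric])
qed (simp add: word_val_Cons)

lemma word_val_foldr_push:
  assumes f: "f \<in> X \<rightarrow> carrier G" and w: "snd ` set w \<subseteq> X"
  shows "snd ` set v \<subseteq> X \<Longrightarrow> word_val G f (foldr push v w) = word_val G f v \<otimes> word_val G f w"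
proof (induction v)
  case Nil
  show ?case using word_val_closed[OF assms] by (simp add: word_val_def[of _ _ "[]"])
next
  case (Cons a v)
  have "snd ` set (foldr push v w) \<subseteq> X"
    using set_foldr_push[of v w] Cons.prems w by force
  then show ?case
    using Cons word_val_push[OF f, of a "foldr push v w"] word_val_closed[OF f] w
      letter_val_closed[OF f]
    by (auto simp: word_val_Cons m_assoc)
qed

text \<open>The universal property of the free group.\<close>

lemma free_group_universal:
  assumes f: "f \<in> X \<rightarrow> carrier G"
  shows "\<exists>h\<in>hom (free_group X) G. (\<forall>x\<in>X. h [(True, x)] = f x) \<and>
           (\<forall>h'\<in>hom (free_group X) G. (\<forall>x\<in>X. h' [(True, x)] = f x) \<longrightarrow>
              (\<forall>w\<in>carrier (free_group X). h' w = h w))"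
proof (rule bexI[of _ "word_val G f"], intro conjI ballI impI)
  show "word_val G f \<in> hom (free_group X) G"
    using word_val_closed[OF f] word_val_foldr_push[OF f]
    by (auto simp: hom_def free_group_def)
  show "word_val G f [(True, x)] = f x" if "x \<in> X" for x
    using funcset_mem[OF f that] by (simp add: word_val_def letter_val_def)
next
  fix h' w
  assume h': "h' \<in> hom (free_group X) G" and gen: "\<forall>x\<in>X. h' [(True, x)] = f x"
    and w: "w \<in> carrier (free_group X)"
  interpret FG: group "free_group X" by (rule group_free_group)
  interpret H: group_hom "free_group X" G h'
    using h' by unfold_locales
  have letter: "h' [a] = letter_val G f a" if "snd a \<in> X" for a
  proof -
    have pos: "[(True, snd a)] \<in> carrier (free_group X)"
      and neg: "[(False, snd a)] \<in> carrier (free_group X)"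
      using that by (auto simp: free_group_def reduced_def)
    have "[(False, snd a)] \<otimes>\<^bsub>free_group X\<^esub> [(True, snd a)] = \<one>\<^bsub>free_group X\<^esub>"
      by (simp add: free_group_def flip_def)
    then have "[(False, snd a)] = inv\<^bsub>free_group X\<^esub> [(True, snd a)]"
      using pos neg FG.inv_equality by metis
    then have "h' [(False, snd a)] = inv (f (snd a))"
      using H.hom_inv[OF pos] gen that by simp
    then show ?thesis
      using gen that by (cases a) (auto simp: letter_val_def)
  qed
  from w show "h' w = word_val G f w"
  proof (induction w)
    case Nil
    then show ?case using H.hom_one by (simp add: free_group_def word_val_def)
  next
    case (Cons a w)
    have cs: "[a] \<in> carrier (free_group X)" "w \<in> carrier (free_group X)" "snd a \<in> X"
      using Cons.prems by (auto simp: free_group_def reduced_def successively_Cons)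
    have "a # w = [a] \<otimes>\<^bsub>free_group X\<^esub> w"
      using Cons.prems by (cases w) (auto simp: free_group_def reduced_def)
    then have "h' (a # w) = h' [a] \<otimes> h' w"
      using H.hom_mult[OF cs(1,2)] by simp
    then show ?case
      using Cons.IH cs letter by (simp add: word_val_Cons)
  qed
qed

end

section \<open>Roots and exponents\<close>

definition exponent_of :: "('a, 'b) monoid_scheme \<Rightarrow> 'a \<Rightarrow> nat" where
  "exponent_of F w = (GREATEST r. r \<ge> 1 \<and> (\<exists>v\<in>carrier F. w = v [^]\<^bsub>F\<^esub> r))"

definition root_of :: "('a, 'b) monoid_scheme \<Rightarrow> 'a \<Rightarrow> 'a" where
  "root_of F w = (THE u. u \<in> carrier F \<and> w = u [^]\<^bsub>F\<^esub> exponent_of F w)"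

section \<open>The groups whose order is a product of primes in a given set\<close>

definition product_of_primes_in :: "nat set \<Rightarrow> nat \<Rightarrow> bool" where
  "product_of_primes_in P n \<longleftrightarrow> (\<exists>A. set_mset A \<subseteq> P \<and> n = prod_mset A)"

definition perp :: "nat set \<Rightarrow> nat set" where
  "perp P = {p. prime p \<and> p \<notin> P}"

definition nu :: "nat set \<Rightarrow> nat \<Rightarrow> nat" where
  "nu P k = Max {d. d dvd k \<and> product_of_primes_in P d}"

definition GP :: "nat set \<Rightarrow> 'c monoid set" where
  "GP P = {H. group H \<and> finite (carrier H) \<and> product_of_primes_in P (order H)}"

section \<open>The pro-V topology\<close>

text \<open>A pseudovariety of finite groups is represented by its members with carrier in
  \<^typ>\<open>nat\<close>; every finite group has an isomorphic copy of this kind. The sets below are the preimages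
  of (open) subsets of discrete members of \<open>V\<close>, so this is the coarsest topology making all
  homomorphisms into members of \<open>V\<close> continuous.\<close>

definition pro_topology :: "nat monoid set \<Rightarrow> ('a, 'b) monoid_scheme \<Rightarrow> 'a topology" where
  "pro_topology V G = topology_generated_by
     {{x \<in> carrier G. h x \<in> S} | h H S. H \<in> V \<and> h \<in> hom G H \<and> S \<subseteq> carrier H}"

lemma topspace_pro_topology_GP: "topspace (pro_topology (GP P) G) = carrier G"
proof -
  define T :: "nat monoid" where "T = \<lparr>carrier = {0}, monoid.mult = (\<lambda>_ _. 0), one = 0\<rparr>"
  have "group T" by (rule groupI) (auto simp: T_def)
  moreover have "product_of_primes_in P 1"
    unfolding product_of_primes_in_def by (rule exI[of _ "{#}"]) simp
  ultimately have T: "T \<in> GP P" by (simp add: GP_def T_def order_def)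
  have "(\<lambda>_. 0) \<in> hom G T" by (simp add: hom_def T_def)
  moreover have "carrier G = {x \<in> carrier G. (0::nat) \<in> carrier T}" by (simp add: T_def)
  ultimately show ?thesis
    using T unfolding pro_topology_def topology_generated_by_topspace by blast
qed

text \<open>The restriction to carriers in \<^typ>\<open>nat\<close> loses nothing: homomorphisms into members of the
  class over any type are continuous.\<close>

lemma continuous_map_pro_topology_GP:
  fixes G :: "('a, 'b) monoid_scheme" and H :: "'c monoid"
  assumes H: "H \<in> GP P" and h: "h \<in> hom G H"
  shows "continuous_map (pro_topology (GP P) G) (discrete_topology (carrier H)) h"
proof -
  interpret H: group H using H by (simp add: GP_def)
  from H have "finite (carrier H)" by (simp add: GP_def)
  then obtain \<phi> :: "'c \<Rightarrow> nat" where inj: "inj_on \<phi> (carrier H)"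
    using finite_imp_inj_to_nat_seg[OF \<open>finite (carrier H)\<close>] that by metis
  define \<psi> where "\<psi> = inv_into (carrier H) \<phi>"
  define K :: "nat monoid" where
    "K = \<lparr>carrier = \<phi> ` carrier H, monoid.mult = (\<lambda>x y. \<phi> (\<psi> x \<otimes>\<^bsub>H\<^esub> \<psi> y)), one = \<phi> \<one>\<^bsub>H\<^esub>\<rparr>"
  have psi [simp]: "\<psi> (\<phi> x) = x" if "x \<in> carrier H" for x
    using inj that by (simp add: \<psi>_def)
  have "group K"
  proof (rule groupI)
    fix x assume "x \<in> carrier K"
    then obtain y where "y \<in> carrier H" "x = \<phi> y" by (auto simp: K_def)
    then show "\<exists>z\<in>carrier K. z \<otimes>\<^bsub>K\<^esub> x = \<one>\<^bsub>K\<^esub>"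
      by (intro bexI[of _ "\<phi> (inv\<^bsub>H\<^esub> y)"]) (auto simp: K_def)
  qed (auto simp: K_def H.m_assoc)
  moreover have "order K = order H"
    using inj by (simp add: order_def K_def card_image)
  ultimately have K: "K \<in> GP P" using H by (auto simp: GP_def K_def)
  have h': "\<phi> \<circ> h \<in> hom G K" using h by (auto simp: hom_def K_def Pi_def)
  have "openin (pro_topology (GP P) G) {x \<in> carrier G. h x \<in> U}" if U: "U \<subseteq> carrier H" for U
  proof -
    have "{x \<in> carrier G. h x \<in> U} = {x \<in> carrier G. (\<phi> \<circ> h) x \<in> \<phi> ` U}"
      using h U inj by (auto simp: hom_def Pi_def inj_on_def)
    moreover have "\<phi> ` U \<subseteq> carrier K" using U by (auto simp: K_def)
    ultimately show ?thesis
      using K h' unfolding pro_topology_def by (intro topology_generated_by_Basis) blast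
  qed
  then show ?thesis
    using h by (auto simp: continuous_map topspace_pro_topology_GP hom_def)
qed

end

theory Submission
  imports Defs "HOL-Algebra.Multiplicative_Group"
begin

text \<open>
  A free group is residually a finite \<open>q\<close>-group for every prime \<open>q\<close>: a nontrivial reduced word whose
  syllables have generators \<open>x\<^sub>1, \<dots>, x\<^sub>k\<close> and exponents \<open>e\<^sub>1, \<dots>, e\<^sub>k\<close> is sent by \<open>x \<mapsto> I + \<Sum>{E\<^sub>i\<^sub>,\<^sub>i\<^sub>+\<^sub>1. x\<^sub>i = x}\<close> to a unitriangular matrix with top
  right entry \<open>e\<^sub>1 \<cdots> e\<^sub>k\<close>, nonzero modulo a large power of \<open>q\<close>. Using all \<open>q\<close> at once, free groups
  are torsion-free with unique roots. Commuting elements are powers of a common element, so the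
  centralizer of \<open>u = root w\<close> is \<open>\<langle>u\<rangle>\<close>. If \<open>n\<close> is a product of primes in \<open>P\<close>, then \<open>\<langle>u\<^sup>n\<rangle>\<close> is closed: an
  element \<open>g\<close> not commuting with \<open>u\<close> is separated from it by a finite image where \<open>[u, g]\<close> survives, and
  \<open>u\<^sup>k\<close> with \<open>n\<close> not dividing \<open>k\<close> by a \<open>q\<close>-group where \<open>u\<close> has large order. Finally \<open>u\<^sup>n\<close> for
  \<open>n = \<nu>\<^sub>P(e)\<close> lies in the closure of \<open>\<langle>u\<^sup>e\<rangle>\<close>, since \<open>e / n\<close> is invertible modulo the order of any member
  of \<open>G\<^sub>P\<close>.
\<close>

section \<open>Unitriangular matrices modulo an integer\<close>

text \<open>The \<open>k + 1\<close> by \<open>k + 1\<close> upper unitriangular matrices over the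
  integers modulo \<open>m\<close>, extended by the identity to all indices so that equality of
  matrices is equality of functions. Upper triangularity lets the product sum over
  \<open>l \<le> j\<close> only.\<close>

definition unitri :: "nat \<Rightarrow> int \<Rightarrow> (nat \<Rightarrow> nat \<Rightarrow> int) monoid" where
  "unitri k m =
     \<lparr>carrier = {M. \<forall>i j. if i < j \<and> j \<le> k then M i j \<in> {0..<m} else M i j = of_bool (i = j)},
      monoid.mult = (\<lambda>M N i j. (\<Sum>l\<le>j. M i l * N l j) mod m),
      one = (\<lambda>i j. of_bool (i = j))\<rparr>"

lemma unitri_entry:
  assumes "M \<in> carrier (unitri k m)"
  shows "j < i \<Longrightarrow> M i j = 0" "M i i = 1" "k < j \<Longrightarrow> i \<noteq> j \<Longrightarrow> M i j = 0"
    "i \<noteq> j \<Longrightarrow> m > 1 \<Longrightarrow> 0 \<le> M i j \<and> M i j < m"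
proof -
  have *: "if i < j \<and> j \<le> k then M i j \<in> {0..<m} else M i j = of_bool (i = j)" for i j
    using assms unfolding unitri_def partial_object.simps mem_Collect_eq by blast
  show "j < i \<Longrightarrow> M i j = 0" "M i i = 1" "k < j \<Longrightarrow> i \<noteq> j \<Longrightarrow> M i j = 0"
    using *[of i j] *[of i i] by auto
  show "i \<noteq> j \<Longrightarrow> m > 1 \<Longrightarrow> 0 \<le> M i j \<and> M i j < m"
    using *[of i j] by (cases "i < j \<and> j \<le> k") auto
qed

lemma unitri_mod:
  assumes "M \<in> carrier (unitri k m)" "m > 1"
  shows "M i j mod m = M i j"
  using unitri_entry(4)[OF assms(1), of i j] unitri_entry(2)[OF assms(1), of i] assms(2)
  by (cases "i = j") auto

lemma unitri_mult: "(M \<otimes>\<^bsub>unitri k m\<^esub> N) i j = (\<Sum>l\<le>j. M i l * N l j) mod m"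
  by (simp add: unitri_def)

lemma unitri_one: "\<one>\<^bsub>unitri k m\<^esub> i j = of_bool (i = j)"
  by (simp add: unitri_def)

lemma unitri_mult_closed:
  assumes M: "M \<in> carrier (unitri k m)" and N: "N \<in> carrier (unitri k m)" and m: "m > 1"
  shows "M \<otimes>\<^bsub>unitri k m\<^esub> N \<in> carrier (unitri k m)"
proof -
  have low: "(M \<otimes>\<^bsub>unitri k m\<^esub> N) i j = 0" if "j < i" for i j
    using that unitri_entry(1)[OF M] by (simp add: unitri_mult)
  have diag: "(M \<otimes>\<^bsub>unitri k m\<^esub> N) i i = 1" for i
  proof -
    have "(\<Sum>l\<le>i. M i l * N l i) = (\<Sum>l\<in>{i}. M i l * N l i)"
      using unitri_entry(1)[OF M] by (intro sum.mono_neutral_right) auto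
    then show ?thesis using unitri_entry(2)[OF M] unitri_entry(2)[OF N] m by (simp add: unitri_mult)
  qed
  have out: "(M \<otimes>\<^bsub>unitri k m\<^esub> N) i j = 0" if "k < j" "i < j" for i j
  proof -
    have "M i l * N l j = 0" if "l \<le> j" for l
      using unitri_entry(3)[OF M, of j i] unitri_entry(3)[OF N, of j l] \<open>k < j\<close> \<open>i < j\<close>
      by (cases "l = j") auto
    then have "(\<Sum>l\<le>j. M i l * N l j) = 0" by (intro sum.neutral) auto
    then show ?thesis by (simp add: unitri_mult)
  qed
  have "(M \<otimes>\<^bsub>unitri k m\<^esub> N) i j \<in> {0..<m}" for i j
    using m by (simp add: unitri_mult)
  moreover have "(M \<otimes>\<^bsub>unitri k m\<^esub> N) i j = of_bool (i = j)" if "\<not> (i < j \<and> j \<le> k)" for i j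
    using that low[of j i] diag[of i] out[of j i] by (cases i j rule: linorder_cases) auto
  ultimately show ?thesis by (simp add: unitri_def)
qed

lemma unitri_assoc:
  assumes M: "M \<in> carrier (unitri k m)" and N: "N \<in> carrier (unitri k m)"
  shows "M \<otimes>\<^bsub>unitri k m\<^esub> N \<otimes>\<^bsub>unitri k m\<^esub> R = M \<otimes>\<^bsub>unitri k m\<^esub> (N \<otimes>\<^bsub>unitri k m\<^esub> R)"
proof (intro ext)
  fix i j
  have "(M \<otimes>\<^bsub>unitri k m\<^esub> N \<otimes>\<^bsub>unitri k m\<^esub> R) i j
      = (\<Sum>l\<le>j. ((\<Sum>r\<le>l. M i r * N r l) mod m) * R l j mod m) mod m"
    by (simp add: unitri_mult mod_sum_eq)
  also have "\<dots> = (\<Sum>l\<le>j. (\<Sum>r\<le>l. M i r * N r l) * R l j) mod m"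
    by (simp add: mod_mult_left_eq mod_sum_eq)
  also have "(\<Sum>l\<le>j. (\<Sum>r\<le>l. M i r * N r l) * R l j) = (\<Sum>l\<le>j. (\<Sum>r\<le>j. M i r * N r l) * R l j)"
    using unitri_entry(1)[OF N]
    by (intro sum.cong arg_cong2[where f = "(*)"] sum.mono_neutral_left) auto
  also have "\<dots> = (\<Sum>l\<le>j. \<Sum>r\<le>j. M i r * (N r l * R l j))"
    by (simp add: sum_distrib_right mult.assoc)
  also have "\<dots> = (\<Sum>r\<le>j. M i r * (\<Sum>l\<le>j. N r l * R l j))"
    by (subst sum.swap) (simp add: sum_distrib_left)
  also have "\<dots> mod m = (\<Sum>r\<le>j. M i r * ((\<Sum>l\<le>j. N r l * R l j) mod m) mod m) mod m"
    by (simp add: mod_mult_right_eq mod_sum_eq)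
  also have "\<dots> = (M \<otimes>\<^bsub>unitri k m\<^esub> (N \<otimes>\<^bsub>unitri k m\<^esub> R)) i j"
    by (simp add: unitri_mult mod_sum_eq)
  finally show "(M \<otimes>\<^bsub>unitri k m\<^esub> N \<otimes>\<^bsub>unitri k m\<^esub> R) i j = (M \<otimes>\<^bsub>unitri k m\<^esub> (N \<otimes>\<^bsub>unitri k m\<^esub> R)) i j" .
qed

lemma card_unitri:
  assumes "m > 1"
  shows "finite (carrier (unitri k m))"
    and "order (unitri k m) = nat m ^ card {(i, j). i < j \<and> j \<le> k}"
proof -
  let ?D = "{(i, j). i < j \<and> j \<le> k}"
  have fin: "finite ?D"
    by (rule finite_subset[of _ "{..k} \<times> {..k}"]) auto
  have "bij_betw (\<lambda>M. restrict (\<lambda>(i, j). M i j) ?D) (carrier (unitri k m)) (PiE ?D (\<lambda>_. {0..<m}))"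
  proof (rule bij_betw_byWitness[where f' = "\<lambda>f i j. if (i, j) \<in> ?D then f (i, j) else of_bool (i = j)"])
    show "\<forall>M\<in>carrier (unitri k m). (\<lambda>i j. if (i, j) \<in> ?D then restrict (\<lambda>(i, j). M i j) ?D (i, j)
        else of_bool (i = j)) = M"
      by (auto simp: unitri_def fun_eq_iff)
  qed (auto simp: unitri_def restrict_def PiE_def extensional_def fun_eq_iff split: if_splits)
  then show "finite (carrier (unitri k m))" "order (unitri k m) = nat m ^ card ?D"
    using fin by (auto simp: bij_betw_finite card_PiE order_def finite_PiE dest: bij_betw_same_card)
qed

text \<open>As \<open>R\<close> has ones on its diagonal, column \<open>j\<close> of a product with
  \<open>R\<close> is column \<open>j\<close> of the left factor plus terms from earlier columns;
  induction on \<open>j\<close> recovers the left factor.\<close>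

lemma unitri_cancel_right:
  assumes M: "M \<in> carrier (unitri k m)" and N: "N \<in> carrier (unitri k m)"
    and R: "R \<in> carrier (unitri k m)" and m: "m > 1"
    and eq: "M \<otimes>\<^bsub>unitri k m\<^esub> R = N \<otimes>\<^bsub>unitri k m\<^esub> R"
  shows "M = N"
proof -
  have "M i j = N i j" for i j
  proof (induction j rule: less_induct)
    case (less j)
    have *: "(A \<otimes>\<^bsub>unitri k m\<^esub> R) i j = ((\<Sum>l<j. A i l * R l j) + A i j) mod m" for A
      using unitri_entry(2)[OF R] by (simp add: unitri_mult lessThan_Suc_atMost[symmetric])
    have "((\<Sum>l<j. N i l * R l j) + M i j) mod m = ((\<Sum>l<j. N i l * R l j) + N i j) mod m"
      using fun_cong[OF fun_cong[OF eq, of i], of j] less by (simp add: *)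
    then have "M i j mod m = N i j mod m" 
      by (simp add: mod_eq_dvd_iff)
    then show ?case using unitri_mod[OF M m] unitri_mod[OF N m] by simp
  qed
  then show ?thesis by blast
qed

lemma group_unitri:
  assumes m: "m > 1"
  shows "group (unitri k m)"
proof (rule groupI)
  show one: "\<one>\<^bsub>unitri k m\<^esub> \<in> carrier (unitri k m)"
    using m by (simp add: unitri_def)
  fix M assume M: "M \<in> carrier (unitri k m)"
  \<comment> \<open>Right multiplication by \<open>M\<close> is injective on a finite set, hence
    surjective; a preimage of the identity is a left inverse.\<close>
  have "(\<lambda>N. N \<otimes>\<^bsub>unitri k m\<^esub> M) ` carrier (unitri k m) = carrier (unitri k m)"
    using M m card_unitri(1)[OF m] unitri_mult_closed unitri_cancel_right
    by (intro endo_inj_surj) (auto simp: inj_on_def)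
  then show "\<exists>N\<in>carrier (unitri k m). N \<otimes>\<^bsub>unitri k m\<^esub> M = \<one>\<^bsub>unitri k m\<^esub>"
    using one by (metis imageE)
  show "\<one>\<^bsub>unitri k m\<^esub> \<otimes>\<^bsub>unitri k m\<^esub> M = M"
  proof (intro ext)
    fix i j
    have "(\<Sum>l\<le>j. of_bool (i = l) * M l j) = (\<Sum>l\<in>{i}. of_bool (i = l) * M l j)"
      using unitri_entry(1)[OF M] by (intro sum.mono_neutral_cong) auto
    then show "(\<one>\<^bsub>unitri k m\<^esub> \<otimes>\<^bsub>unitri k m\<^esub> M) i j = M i j"
      using unitri_mod[OF M m] by (simp add: unitri_mult unitri_one)
  qed
qed (use unitri_assoc unitri_mult_closed m in auto)

lemma unitri_in_GP:
  assumes "prime q" "N > 0"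
  shows "unitri k (int q ^ N) \<in> GP {q}"
proof -
  have m: "int q ^ N > 1" using assms prime_gt_1_nat[of q] by simp
  have "order (unitri k (int q ^ N)) = q ^ (N * card {(i, j). i < j \<and> j \<le> k})"
    using card_unitri(2)[OF m] by (simp add: nat_power_eq power_mult)
  then have "product_of_primes_in {q} (order (unitri k (int q ^ N)))"
    unfolding product_of_primes_in_def
    by (intro exI[of _ "replicate_mset (N * card {(i, j). i < j \<and> j \<le> k}) q"]) auto
  then show ?thesis using group_unitri[OF m] card_unitri(1)[OF m] by (simp add: GP_def)
qed

text \<open>The matrix \<open>I + e A\<close> where \<open>A\<close> is the sum of the matrix units \<open>E\<^sub>i\<^sub>,\<^sub>i\<^sub>+\<^sub>1\<close> with \<open>xs ! i = x\<close>;
  if \<open>xs\<close> has no equal neighbours then \<open>A\<close> squares to zero, so \<open>e \<mapsto> I + e A\<close> is additive.\<close>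

definition transv :: "int \<Rightarrow> 'x list \<Rightarrow> 'x \<Rightarrow> int \<Rightarrow> nat \<Rightarrow> nat \<Rightarrow> int" where
  "transv m xs x e i j =
     (if j = i then 1 else if j = Suc i \<and> i < length xs \<and> xs ! i = x then e mod m else 0)"

lemma transv_closed: "m > 1 \<Longrightarrow> transv m xs x e \<in> carrier (unitri (length xs) m)"
  by (auto simp: unitri_def transv_def)

text \<open>Row \<open>i\<close> of \<open>I + e A\<close> can be nonzero only in columns
  \<open>i\<close> and \<open>Suc i\<close>, so left multiplication is a row operation: it adds
  \<open>e\<close> times row \<open>Suc i\<close> to row \<open>i\<close> wherever
  \<open>xs ! i = x\<close>.\<close>

lemma transv_mult:
  assumes M: "M \<in> carrier (unitri (length xs) m)" and m: "m > 1"
  shows "(transv m xs x e \<otimes>\<^bsub>unitri (length xs) m\<^esub> M) i j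
    = (M i j + (if i < length xs \<and> xs ! i = x then e * M (Suc i) j else 0)) mod m"
proof -
  have "(\<Sum>l\<le>j. transv m xs x e i l * M l j) = (\<Sum>l\<in>{i, Suc i}. transv m xs x e i l * M l j)"
    using unitri_entry(1)[OF M] by (intro sum.mono_neutral_cong) (auto simp: transv_def)
  also have "\<dots> = M i j + (if i < length xs \<and> xs ! i = x then (e mod m) * M (Suc i) j else 0)"
    by (simp add: transv_def)
  finally show ?thesis
    using mod_add_right_eq[of "M i j" "(e mod m) * M (Suc i) j" m]
      mod_add_right_eq[of "M i j" "e * M (Suc i) j" m]
    by (simp add: unitri_mult mod_mult_left_eq)
qed

lemma transv_add:
  assumes m: "m > 1" and xs: "distinct_adj xs"
  shows "transv m xs x (a + b) = transv m xs x a \<otimes>\<^bsub>unitri (length xs) m\<^esub> transv m xs x b"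
proof (intro ext)
  fix i j
  \<comment> \<open>The product of the two off-diagonal parts could be nonzero only where two
    neighbours in \<open>xs\<close> are both \<open>x\<close>.\<close>
  have "\<not> (Suc i < length xs \<and> xs ! i = x \<and> xs ! Suc i = x)"
    using xs by (auto simp: distinct_adj_conv_nth)
  then show "transv m xs x (a + b) i j
      = (transv m xs x a \<otimes>\<^bsub>unitri (length xs) m\<^esub> transv m xs x b) i j"
    using m by (auto simp: transv_mult[OF transv_closed[OF m] m] transv_def mod_simps add.commute)
qed

lemma transv_int_pow:
  assumes m: "m > 1" and xs: "distinct_adj xs"
  shows "transv m xs x 1 [^]\<^bsub>unitri (length xs) m\<^esub> (e::int) = transv m xs x e"
proof -
  let ?U = "unitri (length xs) m"
  interpret group ?U by (rule group_unitri[OF m])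
  have zero: "transv m xs x 0 = \<one>\<^bsub>?U\<^esub>"
    by (auto simp: transv_def unitri_one fun_eq_iff)
  have nat: "transv m xs x 1 [^]\<^bsub>?U\<^esub> (n::nat) = transv m xs x (int n)" for n
    by (induction n) (simp_all add: zero transv_add[OF m xs, symmetric] add.commute)
  have inv: "transv m xs x (- int n) = inv\<^bsub>?U\<^esub> (transv m xs x (int n))" for n
    using transv_add[OF m xs, of x "- int n" "int n"] zero transv_closed[OF m]
    by (intro inv_equality[symmetric]) auto
  show ?thesis
    by (cases e rule: int_cases2) (simp_all add: int_pow_int int_pow_neg transv_closed[OF m] nat inv)
qed

section \<open>Free groups are residually finite \<open>q\<close>-groups\<close>

definition letter_sign :: "'x letter \<Rightarrow> int" where
  "letter_sign a = (if fst a then 1 else -1)"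

text \<open>The pair \<open>(x, e)\<close> stands for the power of \<open>x\<close> with exponent
  \<open>e\<close>. A merged syllable of exponent zero is kept; in \<open>syllables w\<close> this
  happens only if \<open>w\<close> is not reduced.\<close>

fun cons_syllable :: "'x letter \<Rightarrow> ('x \<times> int) list \<Rightarrow> ('x \<times> int) list" where
  "cons_syllable a [] = [(snd a, letter_sign a)]"
| "cons_syllable a ((x, e) # ss) =
     (if x = snd a then (x, letter_sign a + e) # ss else (snd a, letter_sign a) # (x, e) # ss)"

definition syllables :: "'x letter list \<Rightarrow> ('x \<times> int) list" where
  "syllables w = foldr cons_syllable w []"

definition syllable_val :: "('g, 'c) monoid_scheme \<Rightarrow> ('x \<Rightarrow> 'g) \<Rightarrow> ('x \<times> int) list \<Rightarrow> 'g" where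
  "syllable_val G f ss = foldr (\<lambda>(x, e) g. f x [^]\<^bsub>G\<^esub> e \<otimes>\<^bsub>G\<^esub> g) ss \<one>\<^bsub>G\<^esub>"

lemma syllables_Cons: "syllables (a # w) = cons_syllable a (syllables w)"
  by (simp add: syllables_def)

text \<open>The sign of the first exponent is carried along to strengthen the induction: in a
  reduced word a letter joins the first syllable only if it has the same sign, so exponents never
  cancel to zero.\<close>

lemma syllables_reduced:
  assumes "reduced w"
  shows "distinct_adj (map fst (syllables w)) \<and> (\<forall>s\<in>set (syllables w). snd s \<noteq> 0) \<and>
    (w \<noteq> [] \<longrightarrow> syllables w \<noteq> [] \<and> fst (hd (syllables w)) = snd (hd w) \<and>
      sgn (snd (hd (syllables w))) = letter_sign (hd w))"
  using assms
proof (induction w)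
  case Nil
  then show ?case by (simp add: syllables_def)
next
  case (Cons a w)
  show ?case
  proof (cases w)
    case Nil
    then show ?thesis by (simp add: syllables_def letter_sign_def)
  next
    case (Cons b v)
    have "reduced w" and ab: "b \<noteq> flip a"
      using Cons.prems Cons by (auto simp: reduced_def)
    with Cons.IH Cons obtain e ss where
      s: "syllables w = (snd b, e) # ss" and e: "sgn e = letter_sign b" and
      IH: "distinct_adj (map fst (syllables w))" "\<forall>s\<in>set (syllables w). snd s \<noteq> 0"
      by (cases "syllables w") auto
    show ?thesis
    proof (cases "snd b = snd a")
      case True
      then have "a = b" using ab by (auto simp: flip_def prod_eq_iff)
      then have "sgn (letter_sign a + e) = letter_sign a"
        using e by (cases e "0::int" rule: linorder_cases) (auto simp: letter_sign_def sgn_if split: if_splits)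
      moreover from this have "letter_sign a + e \<noteq> 0"
        by (auto simp: letter_sign_def split: if_splits)
      ultimately show ?thesis
        using True s IH unfolding syllables_Cons by (cases ss) auto
    next
      case False
      then show ?thesis using s IH unfolding syllables_Cons by (auto simp: letter_sign_def)
    qed
  qed
qed

context group
begin

lemma syllable_val_closed: "f \<in> UNIV \<rightarrow> carrier G \<Longrightarrow> syllable_val G f ss \<in> carrier G"
  by (induction ss) (auto simp: syllable_val_def Pi_def)

lemma syllable_val_Cons:
  "syllable_val G f ((x, e) # ss) = f x [^] e \<otimes> syllable_val G f ss"
  by (simp add: syllable_val_def)

lemma word_val_syllables:
  assumes f: "f \<in> UNIV \<rightarrow> carrier G"
  shows "word_val G f w = syllable_val G f (syllables w)"
proof (induction w)
  case Nil
  show ?case by (simp add: word_val_def syllable_val_def syllables_def)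
next
  case (Cons a w)
  have fx [simp]: "f x \<in> carrier G" for x using f by auto
  have a: "letter_val G f a = f (snd a) [^] letter_sign a"
    by (simp add: letter_val_def letter_sign_def int_pow_neg)
  have "syllable_val G f (cons_syllable a ss) = letter_val G f a \<otimes> syllable_val G f ss" for ss
    using syllable_val_closed[OF f]
    by (cases "(a, ss)" rule: cons_syllable.cases)
      (auto simp: a syllable_val_Cons int_pow_mult m_assoc syllable_val_def)
  then show ?case by (simp add: word_val_Cons Cons syllables_Cons)
qed

end

text \<open>The top right entry of a product of the matrices \<open>I + e\<^sub>s A\<^sub>s\<close>, one for each syllable, comes from
  the only path of length \<open>length ss\<close> going up by one at each step, so it is the product of
  the exponents.\<close>

lemma syllable_val_transv:
  fixes ss :: "('x \<times> int) list"
  defines "xs \<equiv> map fst ss"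
  defines "U i m \<equiv> syllable_val (unitri (length xs) m) (\<lambda>x. transv m xs x 1) (drop i ss)"
  assumes m: "m > 1" and xs: "distinct_adj xs" and i: "i \<le> length ss"
  shows "(\<forall>l<i. U i m l (length ss) = 0) \<and>
    U i m i (length ss) = prod_list (map snd (drop i ss)) mod m"
proof -
  interpret group "unitri (length xs) m" by (rule group_unitri[OF m])
  have f: "(\<lambda>x. transv m xs x 1) \<in> UNIV \<rightarrow> carrier (unitri (length xs) m)"
    using transv_closed[OF m] by auto
  \<comment> \<open>Descending induction from the empty product at \<open>i = length ss\<close>.
    Prefixing syllable \<open>n\<close> adds \<open>e\<close> times row \<open>Suc n\<close> to row
    \<open>n\<close>, whose entry in column \<open>length ss\<close> was still zero; this is why the
    vanishing of the entries above is part of the claim.\<close>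
  from i show ?thesis
  proof (induction rule: inc_induct)
    case base
    then show ?case using m by (auto simp: U_def syllable_val_def unitri_one)
  next
    case (step n)
    obtain x e where xe: "ss ! n = (x, e)" by fastforce
    have d: "drop n ss = (x, e) # drop (Suc n) ss"
      using step.hyps xe by (metis Cons_nth_drop_Suc)
    have closed: "U (Suc n) m \<in> carrier (unitri (length xs) m)"
      unfolding U_def by (rule syllable_val_closed[OF f])
    have "U n m = transv m xs x e \<otimes>\<^bsub>unitri (length xs) m\<^esub> U (Suc n) m"
      by (simp add: U_def d syllable_val_Cons transv_int_pow[OF m xs])
    then have *: "U n m l j = (U (Suc n) m l j +
        (if l < length xs \<and> xs ! l = x then e * U (Suc n) m (Suc l) j else 0)) mod m" for l j
      using transv_mult[OF closed m] by simp
    have "xs ! n = x" "n < length xs"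
      using xe step.hyps by (auto simp: xs_def)
    then show ?case
      using step.IH by (auto simp: * d mod_mult_right_eq)
  qed
qed

lemma word_val_hom:
  assumes "group G" "f \<in> X \<rightarrow> carrier G"
  shows "word_val G f \<in> hom (free_group X) G"
  using group.word_val_closed[OF assms] group.word_val_foldr_push[OF assms]
  by (auto simp: hom_def free_group_def)

lemma free_group_residually_GP:
  assumes w: "w \<in> carrier (free_group X)" "w \<noteq> []" and q: "prime q"
  shows "\<exists>H :: (nat \<Rightarrow> nat \<Rightarrow> int) monoid. \<exists>h. H \<in> GP {q} \<and> h \<in> hom (free_group X) H \<and> h w \<noteq> \<one>\<^bsub>H\<^esub>"
proof -
  define ss where "ss = syllables w"
  define xs where "xs = map fst ss"
  \<comment> \<open>Chosen so that \<open>q ^ N\<close> exceeds the absolute value of the product of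
    the exponents, which is then nonzero modulo \<open>m\<close>.\<close>
  define N where "N = Suc (nat \<bar>prod_list (map snd ss)\<bar>)"
  define m where "m = int q ^ N"
  define f where "f = (\<lambda>x. transv m xs x 1)"
  let ?H = "unitri (length xs) m"
  have "reduced w" using w by (simp add: free_group_def)
  from syllables_reduced[OF this] w have ss: "distinct_adj xs" "ss \<noteq> []" "\<forall>s\<in>set ss. snd s \<noteq> 0"
    by (simp_all add: ss_def xs_def)
  have "N < 2 ^ N" by (rule less_exp)
  also have "2 ^ N \<le> q ^ N" using prime_ge_2_nat[OF q] by (rule power_mono) simp
  finally have "int N < m" by (simp add: m_def flip: of_nat_power)
  then have m: "m > 1" and small: "\<bar>prod_list (map snd ss)\<bar> < m"
    by (simp_all add: N_def)
  interpret H: group ?H by (rule group_unitri[OF m])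
  have f: "f \<in> UNIV \<rightarrow> carrier ?H"
    using transv_closed[OF m] by (auto simp: f_def)
  have "word_val ?H f w 0 (length ss) = prod_list (map snd ss) mod m"
    unfolding H.word_val_syllables[OF f]
    using syllable_val_transv[OF m, of ss 0] ss by (simp add: ss_def f_def xs_def)
  moreover have "prod_list (map snd ss) \<noteq> 0"
    using ss(3) by (auto simp: prod_list_zero_iff)
  then have "prod_list (map snd ss) mod m \<noteq> 0"
    using small by (auto simp: mod_eq_0_iff_dvd dest: zdvd_imp_le dvd_imp_le_int)
  ultimately have "word_val ?H f w \<noteq> \<one>\<^bsub>?H\<^esub>"
    using ss(2) by (auto simp: unitri_one)
  moreover have "?H \<in> GP {q}"
    unfolding m_def by (rule unitri_in_GP[OF q]) (simp add: N_def)
  moreover have "word_val ?H f \<in> hom (free_group X) ?H"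
    using f by (intro word_val_hom H.group_axioms) auto
  ultimately show ?thesis by blast
qed

section \<open>Commuting elements of free groups\<close>

lemma foldr_push_append: "reduced (x @ y) \<Longrightarrow> foldr push x y = x @ y"
  using foldr_push_Nil[of "x @ y"] foldr_push_Nil[of y]
  by (simp add: reduced_def successively_append_iff)

lemma length_push: "length (push a w) \<le> Suc (length w)"
  by (cases w) auto

lemma length_foldr_push: "length (foldr push x y) \<le> length x + length y"
  by (induction x) (auto intro: order_trans[OF length_push])

text \<open>Every cancellation shortens the product, so full length means that none took
  place.\<close>

lemma foldr_push_append_length:
  "length (foldr push x y) = length x + length y \<Longrightarrow> foldr push x y = x @ y"
proof (induction x)
  case (Cons a x)
  have "length (foldr push x y) = length x + length y"
    using Cons.prems length_push[of a "foldr push x y"] length_foldr_push[of x y] by simp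
  moreover have "push a w = a # w" if "length (push a w) = Suc (length w)" for w
    using that by (cases w) (auto split: if_splits)
  ultimately show ?case using Cons by simp
qed simp

lemma free_group_simps:
  "v \<otimes>\<^bsub>free_group X\<^esub> w = foldr push v w" "\<one>\<^bsub>free_group X\<^esub> = []"
  by (simp_all add: free_group_def)

lemma inv_free_group:
  assumes "w \<in> carrier (free_group X)"
  shows "inv\<^bsub>free_group X\<^esub> w = rev (map flip w)"
proof -
  interpret group "free_group X" by (rule group_free_group)
  show ?thesis
    using assms by (intro inv_equality)
      (auto simp: free_group_def foldr_push_inverse reduced_inverse)
qed

lemma free_group_nat_pow:
  assumes "reduced (concat (replicate n z))"
  shows "z [^]\<^bsub>free_group X\<^esub> n = concat (replicate n z)"
  using assms
proof (induction n)
  case 0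
  then show ?case by (simp add: free_group_simps)
next
  case (Suc n)
  have eq: "concat (replicate (Suc n) z) = concat (replicate n z) @ z"
    by (simp add: replicate_append_same[symmetric])
  then have "reduced (concat (replicate n z))"
    using Suc.prems by (simp add: reduced_def successively_append_iff del: concat.simps)
  then have "z [^]\<^bsub>free_group X\<^esub> Suc n = foldr push (concat (replicate n z)) z"
    using Suc.IH by (simp add: free_group_simps)
  then show ?case using Suc.prems foldr_push_append eq by metis
qed

text \<open>Without cancellation the equation holds between plain lists, and commuting words of the
  free monoid are powers of a common word \<open>z\<close>. As \<open>z\<close> is nonempty,
  \<open>m\<close> is at most the length of \<open>x\<close>.\<close>

lemma free_group_commute_no_cancel:
  assumes x: "x \<in> carrier (free_group X)" "x \<noteq> []" and y: "y \<in> carrier (free_group X)"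
    and comm: "x \<otimes>\<^bsub>free_group X\<^esub> y = y \<otimes>\<^bsub>free_group X\<^esub> x" and red: "reduced (x @ y)"
  shows "\<exists>z m n. z \<in> carrier (free_group X) \<and> 1 \<le> m \<and> m \<le> length x \<and>
    x = z [^]\<^bsub>free_group X\<^esub> (m::nat) \<and> y = z [^]\<^bsub>free_group X\<^esub> (n::nat)"
proof -
  have xy: "foldr push x y = x @ y" by (rule foldr_push_append[OF red])
  then have "foldr push y x = x @ y"
    using comm by (simp add: free_group_simps)
  \<comment> \<open>The product of \<open>y\<close> and \<open>x\<close> has full length too, so it
    is also formed without cancellation.\<close>
  then have "x @ y = y @ x"
    using foldr_push_append_length[of y x] by simp
  then obtain m n z where z: "concat (replicate m z) = x" "concat (replicate n z) = y"
    using comm_append_are_replicate by blast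
  with x have "m \<noteq> 0" "z \<noteq> []" by auto
  then obtain m' where m': "m = Suc m'" by (cases m) auto
  have "x = z @ concat (replicate m' z)" using z m' by auto
  then have "z \<in> carrier (free_group X)"
    using x by (auto simp: free_group_def reduced_def successively_append_iff)
  moreover have "length x = m * length z"
    using z(1) by (auto simp: length_concat sum_list_replicate)
  then have "m \<le> length x" using \<open>z \<noteq> []\<close> by (cases z) auto
  moreover have "x = z [^]\<^bsub>free_group X\<^esub> m" "y = z [^]\<^bsub>free_group X\<^esub> n"
    using z x(1) y free_group_nat_pow[of m z X] free_group_nat_pow[of n z X]
    by (simp_all add: free_group_def[of X, THEN arg_cong[where f = carrier]])
  moreover have "1 \<le> m" using m' by simp
  ultimately show ?thesis by blast
qed

lemma (in group) commute_inv:
  assumes x: "x \<in> carrier G" and y: "y \<in> carrier G" and comm: "x \<otimes> y = y \<otimes> x"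
  shows "x \<otimes> inv y = inv y \<otimes> x"
proof -
  have "x \<otimes> inv y = inv y \<otimes> (y \<otimes> x) \<otimes> inv y"
    using x y by (simp flip: m_assoc)
  also have "\<dots> = inv y \<otimes> (x \<otimes> y) \<otimes> inv y" by (simp only: comm)
  also have "\<dots> = inv y \<otimes> x" using x y by (simp add: m_assoc)
  finally show ?thesis .
qed

text \<open>If \<open>x\<close> is cyclically reduced then one of the products of \<open>x\<close> with \<open>y\<close> and with the inverse
  of \<open>y\<close> has no cancellation: otherwise \<open>y\<close> starts with the inverse of the last letter of \<open>x\<close>, and,
  as \<open>x\<close> and \<open>y\<close> commute, ends with the inverse of the first letter of \<open>x\<close>.\<close>

lemma free_group_commute_cyclically_reduced:
  assumes x: "x \<in> carrier (free_group X)" "x \<noteq> []" "hd x \<noteq> flip (last x)"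
    and y: "y \<in> carrier (free_group X)"
    and comm: "x \<otimes>\<^bsub>free_group X\<^esub> y = y \<otimes>\<^bsub>free_group X\<^esub> x"
  shows "\<exists>z m n. z \<in> carrier (free_group X) \<and> 1 \<le> m \<and> m \<le> length x \<and>
    x = z [^]\<^bsub>free_group X\<^esub> (m::nat) \<and> y = z [^]\<^bsub>free_group X\<^esub> (n::int)"
proof -
  interpret group "free_group X" by (rule group_free_group)
  let ?y = "rev (map flip y)"
  have invy: "inv\<^bsub>free_group X\<^esub> y = ?y" by (rule inv_free_group[OF y])
  have redx: "reduced x" and redy: "reduced y" using x y by (auto simp: free_group_def)
  have red: "reduced (a @ b)" if "reduced a" "reduced b" "a = [] \<or> b = [] \<or> hd b \<noteq> flip (last a)"
    for a b :: "'a letter list"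
    using that by (auto simp: reduced_def successively_append_iff)
  have comm': "x \<otimes>\<^bsub>free_group X\<^esub> ?y = ?y \<otimes>\<^bsub>free_group X\<^esub> x"
    using commute_inv[OF x(1) y comm] invy by simp
  consider "reduced (x @ y)" | "reduced (y @ x)" | "reduced (x @ ?y)"
  proof (cases "y = [] \<or> hd y \<noteq> flip (last x) \<or> hd x \<noteq> flip (last y)")
    case True
    then show ?thesis using red[OF redx redy] red[OF redy redx] that by blast
  next
    case False
    then have "hd ?y \<noteq> flip (last x)"
      using x(3) by (auto simp: hd_rev last_map)
    then show ?thesis using red[OF redx reduced_inverse[OF redy]] that by blast
  qed
  then show ?thesis
  proof cases
    case 1
    then show ?thesis
      using free_group_commute_no_cancel[OF x(1,2) y comm] by (metis int_pow_int)
  next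
    case 2
    \<comment> \<open>Comparing lengths, the product of \<open>x\<close> and \<open>y\<close> is
      formed without cancellation as well, which leads back to the first case.\<close>
    have "foldr push y x = y @ x" by (rule foldr_push_append[OF 2])
    then have "length (foldr push x y) = length x + length y"
      using comm by (simp add: free_group_simps)
    then have "foldr push x y = x @ y" by (rule foldr_push_append_length)
    then have "reduced (x @ y)" using reduced_foldr_push[OF redy, of x] by simp
    then show ?thesis
      using free_group_commute_no_cancel[OF x(1,2) y comm] by (metis int_pow_int)
  next
    case 3
    have "?y \<in> carrier (free_group X)" using y invy by (metis inv_closed)
    from free_group_commute_no_cancel[OF x(1,2) this comm' 3] obtain z m n where
      z: "z \<in> carrier (free_group X)" "1 \<le> m" "m \<le> length x" "x = z [^]\<^bsub>free_group X\<^esub> (m::nat)"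
        "?y = z [^]\<^bsub>free_group X\<^esub> (n::nat)" by blast
    then have "y = z [^]\<^bsub>free_group X\<^esub> (- int n)"
      using y invy by (metis int_pow_neg_int inv_inv)
    with z show ?thesis by blast
  qed
qed

text \<open>Strip a first letter together with its inverse at the end and recurse on the inner word;
  the stripped letters collect in the conjugator \<open>c\<close>.\<close>

lemma free_group_cyclic_reduction:
  assumes "w \<in> carrier (free_group X)" "w \<noteq> []"
  shows "\<exists>c x. c \<in> carrier (free_group X) \<and> x \<in> carrier (free_group X) \<and> x \<noteq> [] \<and> hd x \<noteq> flip (last x) \<and>
    w = c \<otimes>\<^bsub>free_group X\<^esub> x \<otimes>\<^bsub>free_group X\<^esub> inv\<^bsub>free_group X\<^esub> c"
  using assms
proof (induction w rule: length_induct)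
  case (1 w)
  interpret group "free_group X" by (rule group_free_group)
  show ?case
  proof (cases "hd w = flip (last w)")
    case False
    then show ?thesis using 1 by (intro exI[of _ "\<one>\<^bsub>free_group X\<^esub>"] exI[of _ w]) auto
  next
    case True
    obtain a u where u: "w = a # u" using 1 by (cases w) auto
    with True have "u \<noteq> []" and "flip (flip (last u)) = flip a" by (auto split: if_splits)
    then obtain v where w: "w = a # v @ [flip a]"
      using u by (metis append_butlast_last_id flip_flip)
    \<comment> \<open>\<open>v\<close> is nonempty because \<open>[a, flip a]\<close> is not
      reduced.\<close>
    have v: "v \<in> carrier (free_group X)" and a: "[a] \<in> carrier (free_group X)"
      and "v \<noteq> []" and red: "reduced (v @ [flip a])" and redw: "reduced w"
      using 1(2) w by (auto simp: free_group_def reduced_def successively_append_iff successively_Cons)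
    have "length v < length w" using w by simp
    with 1(1) v \<open>v \<noteq> []\<close> obtain c x where cx: "c \<in> carrier (free_group X)" "x \<in> carrier (free_group X)" "x \<noteq> []"
      "hd x \<noteq> flip (last x)" "v = c \<otimes>\<^bsub>free_group X\<^esub> x \<otimes>\<^bsub>free_group X\<^esub> inv\<^bsub>free_group X\<^esub> c"
      by blast
    have "w = [a] \<otimes>\<^bsub>free_group X\<^esub> (v \<otimes>\<^bsub>free_group X\<^esub> [flip a])"
      using foldr_push_append[OF red] foldr_push_append[of "[a]" "v @ [flip a]"] redw w
      by (simp add: free_group_simps)
    moreover have "[flip a] = inv\<^bsub>free_group X\<^esub> [a]" using inv_free_group[OF a] by simp
    ultimately have "w = ([a] \<otimes>\<^bsub>free_group X\<^esub> c) \<otimes>\<^bsub>free_group X\<^esub> x \<otimes>\<^bsub>free_group X\<^esub>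
        inv\<^bsub>free_group X\<^esub> ([a] \<otimes>\<^bsub>free_group X\<^esub> c)"
      using a cx by (simp add: m_assoc inv_mult_group)
    then show ?thesis using cx a by blast
  qed
qed

lemma (in group) int_pow_conj:
  assumes "c \<in> carrier G" "x \<in> carrier G"
  shows "(c \<otimes> x \<otimes> inv c) [^] (n::int) = c \<otimes> x [^] n \<otimes> inv c"
proof -
  have "(\<lambda>x. c \<otimes> x \<otimes> inv c) \<in> hom G G"
    using assms by (auto simp: hom_def m_assoc inv_solve_left simp flip: m_assoc[of "inv c" c])
  from hom_int_pow[OF this assms(2) group_axioms group_axioms] show ?thesis by simp
qed

text \<open>Conjugation by \<open>c\<close> transfers the claim from the cyclically reduced core
  \<open>x\<close> of \<open>w\<close>. The bound \<open>N\<close> is the length of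
  \<open>x\<close>, which does not depend on \<open>y\<close>.\<close>

lemma free_group_commute:
  assumes w: "w \<in> carrier (free_group X)" "w \<noteq> []"
  shows "\<exists>N. \<forall>y\<in>carrier (free_group X). w \<otimes>\<^bsub>free_group X\<^esub> y = y \<otimes>\<^bsub>free_group X\<^esub> w \<longrightarrow>
    (\<exists>z\<in>carrier (free_group X). \<exists>m n. 1 \<le> m \<and> m \<le> N \<and>
      w = z [^]\<^bsub>free_group X\<^esub> (m::nat) \<and> y = z [^]\<^bsub>free_group X\<^esub> (n::int))"
proof -
  interpret group "free_group X" by (rule group_free_group)
  obtain c x where cx: "c \<in> carrier (free_group X)" "x \<in> carrier (free_group X)" "x \<noteq> []"
    "hd x \<noteq> flip (last x)" and wc: "w = c \<otimes>\<^bsub>free_group X\<^esub> x \<otimes>\<^bsub>free_group X\<^esub> inv\<^bsub>free_group X\<^esub> c"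
    using free_group_cyclic_reduction[OF w] by blast
  show ?thesis
  proof (intro exI[of _ "length x"] ballI impI)
    fix y assume y: "y \<in> carrier (free_group X)"
      and comm: "w \<otimes>\<^bsub>free_group X\<^esub> y = y \<otimes>\<^bsub>free_group X\<^esub> w"
    define d where "d = inv\<^bsub>free_group X\<^esub> c"
    have d: "d \<in> carrier (free_group X)" "inv\<^bsub>free_group X\<^esub> d = c"
      using cx by (simp_all add: d_def)
    define y' where "y' = d \<otimes>\<^bsub>free_group X\<^esub> y \<otimes>\<^bsub>free_group X\<^esub> c"
    have y': "y' \<in> carrier (free_group X)" using y cx d by (simp add: y'_def)
    have x': "x = d \<otimes>\<^bsub>free_group X\<^esub> w \<otimes>\<^bsub>free_group X\<^esub> c"
      using cx by (simp add: d_def wc m_assoc) (simp flip: m_assoc)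
    have c_d: "c \<otimes>\<^bsub>free_group X\<^esub> (d \<otimes>\<^bsub>free_group X\<^esub> g) = g" if "g \<in> carrier (free_group X)" for g
      using cx that by (simp add: d_def flip: m_assoc)
    have "x \<otimes>\<^bsub>free_group X\<^esub> y' = d \<otimes>\<^bsub>free_group X\<^esub> (w \<otimes>\<^bsub>free_group X\<^esub> y) \<otimes>\<^bsub>free_group X\<^esub> c"
      unfolding x' y'_def using w y cx d by (simp add: m_assoc c_d)
    also have "\<dots> = d \<otimes>\<^bsub>free_group X\<^esub> (y \<otimes>\<^bsub>free_group X\<^esub> w) \<otimes>\<^bsub>free_group X\<^esub> c"
      by (simp only: comm)
    also have "\<dots> = y' \<otimes>\<^bsub>free_group X\<^esub> x"
      unfolding x' y'_def using w y cx d by (simp add: m_assoc c_d)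
    finally obtain z m n where z: "z \<in> carrier (free_group X)" "1 \<le> m" "m \<le> length x"
      "x = z [^]\<^bsub>free_group X\<^esub> (m::nat)" "y' = z [^]\<^bsub>free_group X\<^esub> (n::int)"
      using free_group_commute_cyclically_reduced[OF cx(2-4) y'] by blast
    let ?z = "c \<otimes>\<^bsub>free_group X\<^esub> z \<otimes>\<^bsub>free_group X\<^esub> inv\<^bsub>free_group X\<^esub> c"
    have "w = ?z [^]\<^bsub>free_group X\<^esub> m"
      using int_pow_conj[OF cx(1) z(1), of "int m"] z(4) wc by (simp add: int_pow_int)
    moreover have "y = c \<otimes>\<^bsub>free_group X\<^esub> y' \<otimes>\<^bsub>free_group X\<^esub> d"
      unfolding y'_def using y cx d by (simp add: m_assoc c_d) (simp add: d_def)
    then have "y = ?z [^]\<^bsub>free_group X\<^esub> n"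
      using int_pow_conj[OF cx(1) z(1)] z(5) by (simp add: d_def)
    ultimately show "\<exists>z\<in>carrier (free_group X). \<exists>m n. 1 \<le> m \<and> m \<le> length x \<and>
      w = z [^]\<^bsub>free_group X\<^esub> (m::nat) \<and> y = z [^]\<^bsub>free_group X\<^esub> (n::int)"
      using z cx by blast
  qed
qed

section \<open>The pro-\<open>G\<^sub>P\<close> topology\<close>

lemma product_of_primes_in_iff:
  assumes "\<forall>p\<in>P. prime p"
  shows "product_of_primes_in P n \<longleftrightarrow> n \<noteq> 0 \<and> (\<forall>p. prime p \<longrightarrow> p dvd n \<longrightarrow> p \<in> P)"
proof
  assume "product_of_primes_in P n"
  then obtain A where A: "set_mset A \<subseteq> P" "n = prod_mset A"
    by (auto simp: product_of_primes_in_def)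
  with assms have pr: "\<forall>p\<in>#A. prime p" by blast
  have "p \<in> P" if p: "prime p" "p dvd n" for p
  proof -
    obtain q where "q \<in># A" "p dvd q"
      using p A(2) prime_dvd_prod_mset_iff[OF p(1), of A] by blast
    then show ?thesis using p(1) pr A(1) primes_dvd_imp_eq by blast
  qed
  moreover have "n \<noteq> 0" using A(2) pr by (auto simp: prod_mset_zero_iff)
  ultimately show "n \<noteq> 0 \<and> (\<forall>p. prime p \<longrightarrow> p dvd n \<longrightarrow> p \<in> P)" by blast
next
  assume n: "n \<noteq> 0 \<and> (\<forall>p. prime p \<longrightarrow> p dvd n \<longrightarrow> p \<in> P)"
  then have "set_mset (prime_factorization n) \<subseteq> P" "n = prod_mset (prime_factorization n)"
    by (auto simp: prime_factorization_nat prod_mset_prime_factorization_nat in_prime_factors_iff)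
  then show "product_of_primes_in P n" unfolding product_of_primes_in_def by blast
qed

text \<open>The last claim is maximality: a prime of \<open>P\<close> dividing the quotient could be
  multiplied into \<open>nu P k\<close> to give a larger admissible divisor.\<close>

lemma nu_properties:
  assumes P: "\<forall>p\<in>P. prime p" and k: "k > 0"
  shows "nu P k dvd k" "product_of_primes_in P (nu P k)"
    "prime p \<Longrightarrow> p dvd k div nu P k \<Longrightarrow> p \<notin> P"
proof -
  let ?D = "{d. d dvd k \<and> product_of_primes_in P d}"
  have fin: "finite ?D" using k by auto
  have "1 \<in> ?D" using product_of_primes_in_iff[OF P, of 1] by auto
  then have "nu P k \<in> ?D" unfolding nu_def using fin by (intro Max_in) auto
  then show nu: "nu P k dvd k" "product_of_primes_in P (nu P k)" by auto
  show "p \<notin> P" if p: "prime p" "p dvd k div nu P k"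
  proof
    assume "p \<in> P"
    have "nu P k * p dvd k"
      using nu(1) p(2) by (metis dvd_mult_div_cancel mult_dvd_mono dvd_refl)
    moreover have "product_of_primes_in P (nu P k * p)"
      using nu(2) p(1) \<open>p \<in> P\<close> unfolding product_of_primes_in_iff[OF P]
      by (auto simp: prime_dvd_mult_iff dest: primes_dvd_imp_eq)
    ultimately have "nu P k * p \<le> nu P k"
      unfolding nu_def using fin by (intro Max_ge) auto
    moreover have "nu P k > 0" using nu(1) k by (auto intro: Nat.gr0I)
    ultimately show False using prime_gt_1_nat[OF p(1)] by simp
  qed
qed

lemma nu_eq_iff:
  assumes P: "\<forall>p\<in>P. prime p" and k: "k > 0"
  shows "nu P k = k \<longleftrightarrow> product_of_primes_in P k"
proof
  assume kP: "product_of_primes_in P k"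
  have "finite {d. d dvd k \<and> product_of_primes_in P d}" using k by auto
  then have "k \<le> nu P k" unfolding nu_def using kP by (intro Max_ge) auto
  moreover have "nu P k \<le> k" using nu_properties(1)[OF P k] k by (rule dvd_imp_le)
  ultimately show "nu P k = k" by simp
qed (use nu_properties(2)[OF P k] in simp)

lemma GP_mono: "P \<subseteq> Q \<Longrightarrow> GP P \<subseteq> GP Q"
  unfolding GP_def product_of_primes_in_def by blast

lemma GP_pow_order:
  assumes "H \<in> GP P" "x \<in> carrier H"
  shows "x [^]\<^bsub>H\<^esub> order H = \<one>\<^bsub>H\<^esub>"
  using assms group.pow_order_eq_1[of H x] by (simp add: GP_def)

text \<open>The elements \<open>x y\<^sup>n\<close> serve in place of a basis of neighbourhoods of \<open>x\<close>.\<close>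

lemma pro_topology_GP_pow:
  assumes G: "group G" and P: "\<forall>p\<in>P. prime p"
    and U: "openin (pro_topology (GP P) G) U" and x: "x \<in> U"
  shows "\<exists>n. product_of_primes_in P n \<and> (\<forall>y\<in>carrier G. x \<otimes>\<^bsub>G\<^esub> y [^]\<^bsub>G\<^esub> n \<in> U)"
proof -
  interpret G: group G by fact
  note iff = product_of_primes_in_iff[OF P]
  let ?B = "{{x \<in> carrier G. h x \<in> S} | h (H :: nat monoid) S. H \<in> GP P \<and> h \<in> hom G H \<and> S \<subseteq> carrier H}"
  have "generate_topology_on ?B U"
    using U unfolding pro_topology_def by (rule openin_topology_generated_by)
  then show ?thesis using x
  proof (induction arbitrary: x)
    case Empty
    then show ?case by simp
  next
    case (Int A B)
    then obtain m n where m: "product_of_primes_in P m" "\<forall>y\<in>carrier G. x \<otimes>\<^bsub>G\<^esub> y [^]\<^bsub>G\<^esub> m \<in> A"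
      and n: "product_of_primes_in P n" "\<forall>y\<in>carrier G. x \<otimes>\<^bsub>G\<^esub> y [^]\<^bsub>G\<^esub> n \<in> B"
      by (metis IntD1 IntD2)
    have "product_of_primes_in P (m * n)"
      using m(1) n(1) by (auto simp: iff prime_dvd_mult_iff)
    moreover have "x \<otimes>\<^bsub>G\<^esub> y [^]\<^bsub>G\<^esub> (m * n) \<in> A \<inter> B" if "y \<in> carrier G" for y
    proof -
      \<comment> \<open>A power with exponent \<open>m * n\<close> is both an \<open>m\<close>-th
        and an \<open>n\<close>-th power, so one exponent serves both sets.\<close>
      have "y [^]\<^bsub>G\<^esub> (m * n) = (y [^]\<^bsub>G\<^esub> n) [^]\<^bsub>G\<^esub> m" "y [^]\<^bsub>G\<^esub> (m * n) = (y [^]\<^bsub>G\<^esub> m) [^]\<^bsub>G\<^esub> n"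
        using that by (simp_all add: G.nat_pow_pow mult.commute)
      then show ?thesis using that m(2) n(2) by (metis G.nat_pow_closed IntI)
    qed
    ultimately show ?case by blast
  next
    case (UN K)
    then obtain A where "A \<in> K" "x \<in> A" by blast
    from UN.IH[OF this] show ?case using \<open>A \<in> K\<close> by blast
  next
    case (Basis A)
    then obtain h S and H :: "nat monoid" where H: "H \<in> GP P" and h: "h \<in> hom G H"
      and A: "A = {x \<in> carrier G. h x \<in> S}" by blast
    interpret H: group H using H by (simp add: GP_def)
    interpret h: group_hom G H h using h by unfold_locales
    \<comment> \<open>The exponent \<open>order H\<close> kills \<open>h y\<close>, so
      \<open>h\<close> takes the same value as at \<open>x\<close>.\<close>
    have "x \<otimes>\<^bsub>G\<^esub> y [^]\<^bsub>G\<^esub> order H \<in> A" if y: "y \<in> carrier G" for y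
      using Basis y unfolding A by (simp add: h.hom_nat_pow GP_pow_order[OF H])
    then show ?case using H by (auto simp: GP_def)
  qed
qed

lemma (in group) generate_nat_pow:
  assumes x: "x \<in> carrier G"
  shows "generate G {x [^] (n::nat)} = range (\<lambda>j::int. x [^] (int n * j))"
proof -
  have "(x [^] n) [^] j = x [^] (int n * j)" for j :: int
    using int_pow_pow[OF x, of "int n" j] by (simp only: int_pow_int)
  then show ?thesis using generate_pow[of "x [^] n"] x by auto
qed

text \<open>The fibre of \<open>h\<close> through \<open>g\<close> is an open neighbourhood of
  \<open>g\<close> that misses \<open>S\<close>. The element type of \<open>H\<close> is arbitrary
  so that matrix groups serve directly.\<close>

lemma closedin_pro_topology_GP:
  assumes S: "S \<subseteq> carrier G"
    and sep: "\<And>g. g \<in> carrier G - S \<Longrightarrow>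
      \<exists>(H :: 'c monoid) h. H \<in> GP P \<and> h \<in> hom G H \<and> h g \<notin> h ` S"
  shows "closedin (pro_topology (GP P) G) S"
proof -
  have "\<exists>T. openin (pro_topology (GP P) G) T \<and> g \<in> T \<and> T \<subseteq> carrier G - S"
    if g: "g \<in> carrier G - S" for g
  proof -
    obtain H :: "'c monoid" and h where H: "H \<in> GP P" and h: "h \<in> hom G H" and hg: "h g \<notin> h ` S"
      using sep[OF g] by blast
    have "h g \<in> carrier H" using g h by (auto simp: hom_def)
    then have "openin (pro_topology (GP P) G) {x \<in> carrier G. h x \<in> {h g}}"
      using continuous_map_pro_topology_GP[OF H h]
      by (auto simp: continuous_map topspace_pro_topology_GP simp del: singleton_iff)
    moreover have "{x \<in> carrier G. h x \<in> {h g}} \<subseteq> carrier G - S"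
      using hg by (auto simp: image_iff)
    ultimately show ?thesis using g by blast
  qed
  then have "openin (pro_topology (GP P) G) (carrier G - S)"
    by (subst openin_subopen) blast
  then show ?thesis using S by (simp add: closedin_def topspace_pro_topology_GP)
qed

section \<open>Roots and closures of cyclic subgroups\<close>

text \<open>The properties of free groups that the theorem depends on. The bound \<open>N\<close> makes the exponent
  of \<open>w\<close> well defined, as any \<open>v\<close> with \<open>v\<^sup>r = w\<close> commutes with \<open>w\<close>.\<close>

locale free_like_group = group F for F :: "('a, 'b) monoid_scheme" (structure) +
  assumes residually_GP: "prime q \<Longrightarrow> g \<in> carrier F \<Longrightarrow> g \<noteq> \<one> \<Longrightarrow>
      \<exists>(H :: (nat \<Rightarrow> nat \<Rightarrow> int) monoid) h. H \<in> GP {q} \<and> h \<in> hom F H \<and> h g \<noteq> \<one>\<^bsub>H\<^esub>"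
    and commute_bounded: "w \<in> carrier F \<Longrightarrow> w \<noteq> \<one> \<Longrightarrow>
      \<exists>N. \<forall>y\<in>carrier F. w \<otimes> y = y \<otimes> w \<longrightarrow>
        (\<exists>z\<in>carrier F. \<exists>m n. 1 \<le> m \<and> m \<le> N \<and> w = z [^] (m::nat) \<and> y = z [^] (n::int))"

lemma free_like_group_free_group: "free_like_group (free_group X)"
proof (intro free_like_group.intro free_like_group_axioms.intro group_free_group)
qed (use free_group_residually_GP free_group_commute in \<open>simp_all add: free_group_simps(2)\<close>)

text \<open>Both properties transfer along an isomorphism: homomorphisms are composed with
  \<open>\<phi>\<close>, and the common root \<open>z\<close> is pulled back through it.\<close>

lemma is_free_group_imp_free_like_group:
  assumes "is_free_group F"
  shows "free_like_group F"
proof -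
  obtain X :: "'a set" and \<phi> where F: "group F" and iso: "\<phi> \<in> iso F (free_group X)"
    using assms by (auto simp: is_free_group_def is_iso_def)
  interpret F: group F by fact
  interpret FG: free_like_group "free_group X" by (rule free_like_group_free_group)
  interpret \<phi>: group_hom F "free_group X" \<phi>
    using iso by unfold_locales (simp add: iso_def)
  have bij: "bij_betw \<phi> (carrier F) (carrier (free_group X))" using iso by (simp add: iso_def)
  have one: "\<phi> g \<noteq> \<one>\<^bsub>free_group X\<^esub>" if "g \<in> carrier F" "g \<noteq> \<one>\<^bsub>F\<^esub>" for g
    using bij that by (metis F.one_closed \<phi>.hom_one bij_betw_inv_into_left)
  have inj: "a = b" if "\<phi> a = \<phi> b" "a \<in> carrier F" "b \<in> carrier F" for a b
    using bij that by (auto simp: bij_betw_def inj_on_def)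
  show ?thesis
  proof (intro free_like_group.intro free_like_group_axioms.intro F)
    fix q :: nat and g assume "prime q" "g \<in> carrier F" "g \<noteq> \<one>\<^bsub>F\<^esub>"
    then obtain H :: "(nat \<Rightarrow> nat \<Rightarrow> int) monoid" and h where
      "H \<in> GP {q}" "h \<in> hom (free_group X) H" "h (\<phi> g) \<noteq> \<one>\<^bsub>H\<^esub>"
      using FG.residually_GP[of q "\<phi> g"] one by auto
    then show "\<exists>(H :: (nat \<Rightarrow> nat \<Rightarrow> int) monoid) h. H \<in> GP {q} \<and> h \<in> hom F H \<and> h g \<noteq> \<one>\<^bsub>H\<^esub>"
      using hom_compose[OF \<phi>.homh] by (metis comp_apply)
  next
    fix w assume w: "w \<in> carrier F" "w \<noteq> \<one>\<^bsub>F\<^esub>"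
    then obtain N where N: "\<And>y. y \<in> carrier (free_group X) \<Longrightarrow>
        \<phi> w \<otimes>\<^bsub>free_group X\<^esub> y = y \<otimes>\<^bsub>free_group X\<^esub> \<phi> w \<Longrightarrow>
        (\<exists>z\<in>carrier (free_group X). \<exists>m n. 1 \<le> m \<and> m \<le> N \<and>
          \<phi> w = z [^]\<^bsub>free_group X\<^esub> (m::nat) \<and> y = z [^]\<^bsub>free_group X\<^esub> (n::int))"
      using FG.commute_bounded[OF \<phi>.hom_closed[OF w(1)] one[OF w]] by blast
    show "\<exists>N. \<forall>y\<in>carrier F. w \<otimes>\<^bsub>F\<^esub> y = y \<otimes>\<^bsub>F\<^esub> w \<longrightarrow>
        (\<exists>z\<in>carrier F. \<exists>m n. 1 \<le> m \<and> m \<le> N \<and> w = z [^]\<^bsub>F\<^esub> (m::nat) \<and> y = z [^]\<^bsub>F\<^esub> (n::int))"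
    proof (intro exI[of _ N] ballI impI)
      fix y assume y: "y \<in> carrier F" "w \<otimes>\<^bsub>F\<^esub> y = y \<otimes>\<^bsub>F\<^esub> w"
      then obtain z' m n where z': "z' \<in> carrier (free_group X)" "1 \<le> m" "m \<le> N"
        "\<phi> w = z' [^]\<^bsub>free_group X\<^esub> (m::nat)" "\<phi> y = z' [^]\<^bsub>free_group X\<^esub> (n::int)"
        using N[of "\<phi> y"] w by (metis \<phi>.hom_closed \<phi>.hom_mult)
      obtain z where z: "z \<in> carrier F" "z' = \<phi> z"
        using bij z'(1) by (auto simp: bij_betw_def)
      have "w = z [^]\<^bsub>F\<^esub> m" "y = z [^]\<^bsub>F\<^esub> n"
        using z z' w y by (auto intro!: inj simp: \<phi>.hom_nat_pow \<phi>.hom_int_pow)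
      then show "\<exists>z\<in>carrier F. \<exists>m n. 1 \<le> m \<and> m \<le> N \<and> w = z [^]\<^bsub>F\<^esub> (m::nat) \<and> y = z [^]\<^bsub>F\<^esub> (n::int)"
        using z z' by blast
    qed
  qed
qed

section \<open>Unique roots, torsion-freeness and maximal exponents\<close>

context free_like_group
begin

text \<open>In a finite \<open>q\<close>-group taking \<open>m\<close>-th powers is injective for \<open>m\<close> prime to \<open>q\<close>.\<close>

lemma nat_pow_inj:
  assumes x: "x \<in> carrier F" and y: "y \<in> carrier F" and m: "m > 0" and eq: "x [^] (m::nat) = y [^] m"
  shows "x = y"
proof (rule ccontr)
  assume "x \<noteq> y"
  \<comment> \<open>A prime above \<open>m\<close> does not divide \<open>m\<close>, so
    \<open>m\<close> is coprime to the order of every finite \<open>q\<close>-group.\<close>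
  obtain q where q: "prime q" "m < q" using bigger_prime by blast
  have "x \<otimes> inv y \<noteq> \<one>"
    using x y \<open>x \<noteq> y\<close> by (metis inv_equality inv_closed inv_inv)
  then obtain H :: "(nat \<Rightarrow> nat \<Rightarrow> int) monoid" and h where
    H: "H \<in> GP {q}" and h: "h \<in> hom F H" and ne: "h (x \<otimes> inv y) \<noteq> \<one>\<^bsub>H\<^esub>"
    using residually_GP[OF q(1), of "x \<otimes> inv y"] x y by auto
  interpret H: group H using H by (simp add: GP_def)
  interpret h: group_hom F H h using h by unfold_locales
  have "p = q" if "prime p" "p dvd order H" for p
    using that H product_of_primes_in_iff[of "{q}" "order H"] q(1) by (auto simp: GP_def)
  moreover have "\<not> q dvd m" using q(2) m by (auto dest: dvd_imp_le)
  ultimately have "coprime m (order H)"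
    using prime_factor_nat[of "gcd m (order H)"] by (auto simp: coprime_iff_gcd_eq_1)
  then obtain a b where ab: "a * int m + b * int (order H) = 1"
    using bezout_int[of "int m" "int (order H)"] by (auto simp: coprime_iff_gcd_eq_1)
  \<comment> \<open>By the Bezout relation \<open>ab\<close>, raising to the power \<open>a\<close>
    undoes taking \<open>m\<close>-th powers in \<open>H\<close>.\<close>
  have pow: "g = (g [^]\<^bsub>H\<^esub> m) [^]\<^bsub>H\<^esub> a" if g: "g \<in> carrier H" for g
  proof -
    have "g = g [^]\<^bsub>H\<^esub> (int m * a + int (order H) * b)"
      using ab g by (simp add: mult.commute)
    also have "\<dots> = (g [^]\<^bsub>H\<^esub> int m) [^]\<^bsub>H\<^esub> a \<otimes>\<^bsub>H\<^esub> (g [^]\<^bsub>H\<^esub> int (order H)) [^]\<^bsub>H\<^esub> b"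
      using g by (simp add: H.int_pow_mult H.int_pow_pow)
    also have "\<dots> = (g [^]\<^bsub>H\<^esub> m) [^]\<^bsub>H\<^esub> a"
      using g GP_pow_order[OF H] by (simp add: int_pow_int)
    finally show ?thesis .
  qed
  have "h x [^]\<^bsub>H\<^esub> m = h y [^]\<^bsub>H\<^esub> m" using eq x y by (metis h.hom_nat_pow)
  then have "h x = h y" using pow x y by (metis h.hom_closed)
  then show False using ne x y by simp
qed

text \<open>Torsion-freeness is the case of unique roots in which the other element is
  \<open>\<one>\<close>.\<close>

lemma int_pow_eq_one:
  assumes x: "x \<in> carrier F" "x \<noteq> \<one>" and "x [^] (n::int) = \<one>"
  shows "n = 0"
proof (rule ccontr)
  assume "n \<noteq> 0"
  have "x [^] (nat \<bar>n\<bar>) = \<one>"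
    using assms by (cases n rule: int_cases2) (auto simp: int_pow_int int_pow_neg_int inv_eq_1_iff)
  then have "x = \<one>" using nat_pow_inj[of x \<one> "nat \<bar>n\<bar>"] x \<open>n \<noteq> 0\<close> by simp
  then show False using x by simp
qed

lemma int_pow_cancel:
  assumes x: "x \<in> carrier F" "x \<noteq> \<one>" and eq: "x [^] (m::int) = x [^] n"
  shows "m = n"
proof -
  have "x [^] (m - n) = \<one>" using x eq by (simp add: int_pow_diff)
  then show ?thesis using int_pow_eq_one[OF x] by fastforce
qed

text \<open>Justifies \<open>GREATEST\<close> and \<open>THE\<close> in the definitions: the
  exponents are bounded by \<open>N\<close>, and roots are unique by
  \<open>nat_pow_inj\<close>.\<close>

lemma exponent_of_root_of:
  assumes w: "w \<in> carrier F" "w \<noteq> \<one>"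
  shows "exponent_of F w \<ge> 1" "root_of F w \<in> carrier F" "w = root_of F w [^] exponent_of F w"
    "v \<in> carrier F \<Longrightarrow> w = v [^] r \<Longrightarrow> r \<le> exponent_of F w"
proof -
  let ?R = "\<lambda>r::nat. r \<ge> 1 \<and> (\<exists>v\<in>carrier F. w = v [^] r)"
  obtain N where N: "\<And>y. y \<in> carrier F \<Longrightarrow> w \<otimes> y = y \<otimes> w \<Longrightarrow>
      \<exists>z\<in>carrier F. \<exists>m n. 1 \<le> m \<and> m \<le> N \<and> w = z [^] (m::nat) \<and> y = z [^] (n::int)"
    using commute_bounded[OF w] by blast
  have bound: "r \<le> N" if v: "v \<in> carrier F" "w = v [^] r" for r v
  proof -
    \<comment> \<open>As \<open>v\<close> commutes with its power \<open>w\<close>, both are powers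
      of some \<open>z\<close>, with exponents \<open>n\<close> and \<open>m \<le> N\<close>.
      Torsion-freeness gives \<open>m = n * r\<close>, so \<open>r\<close> divides
      \<open>m\<close>.\<close>
    have "w \<otimes> v = v \<otimes> w" using v by (simp add: nat_pow_comm[of v r 1, simplified])
    then obtain z m n where z: "z \<in> carrier F" "m \<le> N" "1 \<le> m" "w = z [^] (m::nat)" "v = z [^] (n::int)"
      using N[OF v(1)] by blast
    have "z \<noteq> \<one>" using z w by auto
    moreover have "z [^] int m = z [^] (n * int r)"
      using z v(2) by (simp add: int_pow_pow[symmetric] int_pow_int)
    ultimately have "int m = n * int r" using int_pow_cancel z(1) by blast
    then have "int r dvd int m" by simp
    then have "r \<le> m" using z(3) by (intro dvd_imp_le) auto
    then show ?thesis using z(2) by simp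
  qed
  have "?R 1" using w by auto
  then have e: "?R (exponent_of F w)" unfolding exponent_of_def
    by (rule GreatestI_nat[where b = N]) (use bound in auto)
  then show "exponent_of F w \<ge> 1" by simp
  show "r \<le> exponent_of F w" if "v \<in> carrier F" "w = v [^] r"
  proof (cases "r = 0")
    case False
    then show ?thesis unfolding exponent_of_def using that bound
      by (intro Greatest_le_nat[where b = N]) auto
  qed simp
  have "\<exists>!u. u \<in> carrier F \<and> w = u [^] exponent_of F w"
    using e nat_pow_inj[of _ _ "exponent_of F w"] by (metis less_eq_Suc_le One_nat_def)
  from theI'[OF this] show "root_of F w \<in> carrier F" "w = root_of F w [^] exponent_of F w"
    by (auto simp: root_of_def)
qed

text \<open>The root and \<open>v\<close> are powers of a common \<open>z\<close>. If the root is
  the \<open>m\<close>-th power of \<open>z\<close>, then \<open>w\<close> is a power of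
  \<open>z\<close> with exponent \<open>m * exponent_of F w\<close>, and maximality forces
  \<open>m = 1\<close>.\<close>

lemma commute_root_of:
  assumes w: "w \<in> carrier F" "w \<noteq> \<one>" and v: "v \<in> carrier F"
    and comm: "root_of F w \<otimes> v = v \<otimes> root_of F w"
  shows "\<exists>k::int. v = root_of F w [^] k"
proof -
  define u e where "u = root_of F w" and "e = exponent_of F w"
  have u: "u \<in> carrier F" and e: "e \<ge> 1" and wu: "w = u [^] e"
    using exponent_of_root_of(1-3)[OF w] by (simp_all add: u_def e_def)
  then have "u \<noteq> \<one>" using w by auto
  with commute_bounded[OF u] v comm obtain z m n where
    z: "z \<in> carrier F" "1 \<le> m" "u = z [^] (m::nat)" "v = z [^] (n::int)"
    by (auto simp: u_def)
  then have "w = z [^] (m * e)" using wu by (simp add: nat_pow_pow)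
  then have "m * e \<le> e" using exponent_of_root_of(4)[OF w z(1)] unfolding e_def by blast
  then have "m = 1" using e z(2) by simp
  then show ?thesis using z by (auto simp: u_def)
qed

text \<open>A power \<open>u\<^sup>k\<close> outside \<open>\<langle>u\<^sup>n\<rangle>\<close> is detected in a finite \<open>q\<close>-group in which the order of \<open>u\<close>
  is at least the full power \<open>q\<^sup>a\<close> of \<open>q\<close> dividing \<open>n\<close>, for a \<open>q\<close> with \<open>q\<^sup>a\<close> not dividing \<open>k\<close>.\<close>

lemma separate_root_of_power:
  assumes w: "w \<in> carrier F" "w \<noteq> \<one>" and P: "P \<noteq> {}" "\<forall>p\<in>P. prime p"
    and n: "product_of_primes_in P n" and g: "g \<in> carrier F"
    and notin: "\<And>j::int. g \<noteq> root_of F w [^] (int n * j)"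
  shows "\<exists>(H :: (nat \<Rightarrow> nat \<Rightarrow> int) monoid) h. H \<in> GP P \<and> h \<in> hom F H \<and>
    (\<forall>j::int. h g \<noteq> h (root_of F w [^] (int n * j)))"
proof -
  define u where "u = root_of F w"
  have u: "u \<in> carrier F" and "u \<noteq> \<one>"
    using exponent_of_root_of(2,3)[OF w] w by (auto simp: u_def)
  show ?thesis
  proof (cases "u \<otimes> g = g \<otimes> u")
    case False
    obtain q where q: "q \<in> P" "prime q" using P by blast
    \<comment> \<open>A finite image in which this commutator survives suffices: were
      \<open>h g\<close> the image of a power of \<open>u\<close>, it would commute with
      \<open>h u\<close>.\<close>
    have "u \<otimes> g \<otimes> inv (g \<otimes> u) \<noteq> \<one>"
      using False u g by (metis inv_closed inv_equality inv_inv m_closed)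
    then obtain H :: "(nat \<Rightarrow> nat \<Rightarrow> int) monoid" and h where
      H: "H \<in> GP {q}" and h: "h \<in> hom F H" and ne: "h (u \<otimes> g \<otimes> inv (g \<otimes> u)) \<noteq> \<one>\<^bsub>H\<^esub>"
      using residually_GP[OF q(2), of "u \<otimes> g \<otimes> inv (g \<otimes> u)"] u g by blast
    interpret H: group H using H by (simp add: GP_def)
    interpret h: group_hom F H h using h by unfold_locales
    have "h g \<noteq> h (u [^] i)" for i :: int
    proof
      assume "h g = h (u [^] i)"
      moreover have "h u \<otimes>\<^bsub>H\<^esub> h (u [^] i) = h (u [^] i) \<otimes>\<^bsub>H\<^esub> h u"
        using u int_pow_mult[of u 1 i] int_pow_mult[of u i 1]
        by (simp add: add.commute flip: h.hom_mult)
      ultimately have "h (u \<otimes> g) = h (g \<otimes> u)" using u g by simp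
      then have "h (u \<otimes> g \<otimes> inv (g \<otimes> u)) = \<one>\<^bsub>H\<^esub>"
        using u g by (simp del: inv_mult_group)
      then show False using ne by simp
    qed
    moreover have "H \<in> GP P" using H q(1) GP_mono[of "{q}" P] by blast
    ultimately show ?thesis using h unfolding u_def by blast
  next
    case True
    then obtain k :: int where k: "g = u [^] k"
      using commute_root_of[OF w g] by (auto simp: u_def)
    have n0: "n \<noteq> 0" and np: "\<And>p. prime p \<Longrightarrow> p dvd n \<Longrightarrow> p \<in> P"
      using n product_of_primes_in_iff[OF P(2)] by auto
    have "\<not> int n dvd k" using notin k by (auto simp: u_def elim!: dvdE)
    then have "\<not> n dvd nat \<bar>k\<bar>" by (simp add: dvd_nat_abs_iff)
    then obtain q where "prime q" "\<not> multiplicity q n \<le> multiplicity q (nat \<bar>k\<bar>)"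
      using multiplicity_le_imp_dvd[OF n0] by blast
    moreover have "nat \<bar>k\<bar> \<noteq> 0" using \<open>\<not> n dvd nat \<bar>k\<bar>\<close> by (metis dvd_0_right)
    moreover define a where "a = multiplicity q n"
    ultimately have q: "prime q" "q ^ a dvd n" "\<not> q ^ a dvd nat \<bar>k\<bar>"
      using multiplicity_dvd[of q n] multiplicity_geI[of "nat \<bar>k\<bar>" q a] not_prime_unit[of q] by blast+
    \<comment> \<open>\<open>a\<close> is positive because \<open>q ^ 0\<close> divides everything.
      If \<open>u [^] (q ^ b)\<close> with \<open>b = a - 1\<close> has nontrivial image, the order
      of \<open>h u\<close>, being a power of \<open>q\<close>, is divisible by
      \<open>q ^ a\<close>.\<close>
    then obtain b where a: "a = Suc b" by (cases a) auto
    have "q dvd n" using q(2) a by (metis dvd_mult_left power_Suc)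
    have "u [^] (q ^ b) \<noteq> \<one>"
    proof
      assume "u [^] (q ^ b) = \<one>"
      then have "u [^] int (q ^ b) = \<one>" by (simp only: int_pow_int)
      then have "int (q ^ b) = 0" by (rule int_pow_eq_one[OF u \<open>u \<noteq> \<one>\<close>])
      then show False using q(1) by simp
    qed
    then obtain H :: "(nat \<Rightarrow> nat \<Rightarrow> int) monoid" and h where
      H: "H \<in> GP {q}" and h: "h \<in> hom F H" and ne: "h (u [^] (q ^ b)) \<noteq> \<one>\<^bsub>H\<^esub>"
      using residually_GP[OF q(1), of "u [^] (q ^ b)"] u by blast
    interpret H: group H using H by (simp add: GP_def)
    interpret h: group_hom F H h using h by unfold_locales
    have hu: "h u \<in> carrier H" using u by simp
    have "H.ord (h u) dvd order H" using hu by (rule H.ord_dvd_group_order)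
    moreover obtain A where "set_mset A \<subseteq> {q}" "order H = prod_mset A"
      using H by (auto simp: GP_def product_of_primes_in_def)
    then obtain c where "order H = q ^ c"
      by (metis set_mset_subset_singletonD prod_mset_replicate_mset)
    ultimately obtain d where d: "H.ord (h u) = q ^ d"
      using divides_primepow_nat[OF q(1)] by auto
    have "\<not> q ^ d dvd q ^ b"
      using ne hu u H.pow_eq_id[OF hu, of "q ^ b"] by (simp add: d h.hom_nat_pow)
    then have "a \<le> d" using a by (metis le_imp_power_dvd not_less_eq_eq)
    then have qd: "q ^ a dvd H.ord (h u)" using d by (simp add: le_imp_power_dvd)
    have "h g \<noteq> h (u [^] (int n * j))" for j
    proof
      assume "h g = h (u [^] (int n * j))"
      then have "h u [^]\<^bsub>H\<^esub> k = h u [^]\<^bsub>H\<^esub> (int n * j)"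
        using u k by (simp add: h.hom_int_pow)
      then have "int (H.ord (h u)) dvd k - int n * j"
        using H.int_pow_eq[OF hu] by (metis dvd_diff_commute)
      then have "int (q ^ a) dvd k - int n * j"
        using qd by (meson dvd_trans int_dvd_int_iff)
      moreover have "int (q ^ a) dvd int n * j"
        using q(2) by (meson dvd_mult2 int_dvd_int_iff)
      ultimately have "int (q ^ a) dvd k" by (metis diff_add_cancel dvd_add)
      then show False using q(3) by (simp add: dvd_nat_abs_iff)
    qed
    moreover have "H \<in> GP P" using H np[OF q(1) \<open>q dvd n\<close>] GP_mono[of "{q}" P] by blast
    ultimately show ?thesis using h unfolding u_def by blast
  qed
qed

section \<open>Closures of cyclic subgroups\<close>

lemma closedin_root_of_power:
  assumes w: "w \<in> carrier F" "w \<noteq> \<one>" and P: "P \<noteq> {}" "\<forall>p\<in>P. prime p"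
    and n: "product_of_primes_in P n"
  shows "closedin (pro_topology (GP P) F) (generate F {root_of F w [^] n})"
proof (rule closedin_pro_topology_GP)
  have u: "root_of F w \<in> carrier F" by (rule exponent_of_root_of(2)[OF w])
  have gen: "generate F {root_of F w [^] n} = range (\<lambda>j::int. root_of F w [^] (int n * j))"
    by (rule generate_nat_pow[OF u])
  show "generate F {root_of F w [^] n} \<subseteq> carrier F"
    using u by (intro generate_incl) simp
  fix g assume g: "g \<in> carrier F - generate F {root_of F w [^] n}"
  then show "\<exists>(H :: (nat \<Rightarrow> nat \<Rightarrow> int) monoid) h.
      H \<in> GP P \<and> h \<in> hom F H \<and> h g \<notin> h ` generate F {root_of F w [^] n}"
    using separate_root_of_power[OF w P n, of g] unfolding gen by blast
qed

text \<open>The right-hand side is closed by \<open>closedin_root_of_power\<close>. For minimality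
  put \<open>x = u [^] nu P e\<close>: a neighbourhood of \<open>x [^] k\<close> contains all
  \<open>x [^] k \<otimes> y [^] N\<close> for a suitable \<open>N\<close>, and \<open>y\<close> can
  be chosen to make this a power of \<open>w\<close>.\<close>

lemma closure_of_generate:
  assumes w: "w \<in> carrier F" "w \<noteq> \<one>" and P: "P \<noteq> {}" "\<forall>p\<in>P. prime p"
  defines "u \<equiv> root_of F w" and "e \<equiv> exponent_of F w"
  shows "pro_topology (GP P) F closure_of generate F {w} = generate F {u [^] nu P e}"
proof (rule closure_of_unique)
  have u: "u \<in> carrier F" and e: "e > 0" and wu: "w = u [^] e"
    using exponent_of_root_of(1-3)[OF w] by (simp_all add: u_def e_def)
  note nu = nu_properties[OF P(2) e]
  let ?n = "nu P e" and ?m = "e div nu P e"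
  have en: "e = ?n * ?m" using nu(1) by simp
  have wn: "w = (u [^] ?n) [^] ?m" using wu u en by (simp add: nat_pow_pow)
  have gen: "generate F {x} = range (\<lambda>j::int. x [^] j)" if "x \<in> carrier F" for x
    using generate_pow[OF that] by auto
  show "generate F {w} \<subseteq> generate F {u [^] ?n}"
    unfolding gen[OF w(1)] gen[OF nat_pow_closed[OF u]]
    using u by (auto simp: wn int_pow_int[symmetric] int_pow_pow mult.assoc)
  show "closedin (pro_topology (GP P) F) (generate F {u [^] ?n})"
    unfolding u_def by (rule closedin_root_of_power[OF w P nu(2)])
  fix T assume T: "generate F {w} \<subseteq> T" "closedin (pro_topology (GP P) F) T"
  show "generate F {u [^] ?n} \<subseteq> T"
  proof (rule ccontr)
    let ?x = "u [^] ?n"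
    have x: "?x \<in> carrier F" using u by simp
    assume "\<not> ?thesis"
    then obtain k :: int where k: "?x [^] k \<notin> T" unfolding gen[OF x] by blast
    have "openin (pro_topology (GP P) F) (carrier F - T)"
      using T(2) by (simp add: closedin_def topspace_pro_topology_GP)
    with pro_topology_GP_pow[OF group_axioms P(2), of "carrier F - T" "?x [^] k"] k x
    obtain N where N: "product_of_primes_in P N"
      "\<And>y. y \<in> carrier F \<Longrightarrow> ?x [^] k \<otimes> y [^] N \<in> carrier F - T"
      by auto
    \<comment> \<open>The primes dividing \<open>N\<close> lie in \<open>P\<close>, those dividing
      \<open>?m\<close> do not.\<close>
    have "coprime N ?m"
    proof (rule ccontr)
      assume "\<not> coprime N ?m"
      then obtain p where "prime p" "p dvd N" "p dvd ?m"
        using prime_factor_nat[of "gcd N ?m"] by (auto simp: coprime_iff_gcd_eq_1)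
      then show False using N(1) nu(3) product_of_primes_in_iff[OF P(2)] by blast
    qed
    then obtain a b where ab: "a * int N + b * int ?m = 1"
      using bezout_int[of "int N" "int ?m"] by (auto simp: coprime_iff_gcd_eq_1)
    \<comment> \<open>The choice \<open>y = ?x [^] (- k * a)\<close> makes the total exponent
      \<open>k * (1 - a * int N)\<close>, which is a multiple of \<open>int ?m\<close> by
      \<open>ab\<close>; and \<open>?x [^] ?m\<close> is \<open>w\<close>.\<close>
    have "?x [^] k \<otimes> (?x [^] (- k * a)) [^] N = ?x [^] (k - k * a * int N)"
      using x int_pow_mult[OF x, of k "- (k * a * int N)"] int_pow_pow[OF x, of "- k * a" "int N"]
      by (simp flip: int_pow_int)
    also have "k - k * a * int N = int ?m * (b * k)"
    proof -
      have "k - k * a * int N = k * (a * int N + b * int ?m) - k * a * int N" using ab by simp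
      then show ?thesis by (simp only: algebra_simps)
    qed
    also have "?x [^] (int ?m * (b * k)) = w [^] (b * k)"
      using x by (simp add: wn int_pow_int[symmetric] int_pow_pow)
    also have "\<dots> \<in> T" using T(1) gen[OF w(1)] by blast
    finally show False using N(2)[of "?x [^] (- k * a)"] x by blast
  qed
qed

text \<open>Let \<open>u\<close> be the root and \<open>e\<close> the exponent of \<open>w\<close>.
  Forwards, \<open>v\<close> turns out to be some \<open>u [^] k\<close> with
  \<open>k * p = e * j\<close>, and \<open>p\<close>, not dividing \<open>e\<close>, divides
  \<open>j\<close>. Backwards, if a prime \<open>p\<close> outside \<open>P\<close> divided
  \<open>e\<close>, then \<open>u [^] (e div p)\<close> would violate the implication.\<close>

lemma product_of_primes_exponent_iff:
  assumes w: "w \<in> carrier F" "w \<noteq> \<one>" and P: "\<forall>p\<in>P. prime p"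
  shows "product_of_primes_in P (exponent_of F w) \<longleftrightarrow>
    (\<forall>v\<in>carrier F. \<forall>p\<in>perp P. v [^] p \<in> generate F {w} \<longrightarrow> v \<in> generate F {w})"
proof -
  define u e where "u = root_of F w" and "e = exponent_of F w"
  have u: "u \<in> carrier F" and e: "e > 0" and wu: "w = u [^] e"
    using exponent_of_root_of(1-3)[OF w] by (simp_all add: u_def e_def)
  have u1: "u \<noteq> \<one>" using w wu by auto
  have gen: "generate F {w} = range (\<lambda>j::int. u [^] (int e * j))"
    unfolding wu by (rule generate_nat_pow[OF u])
  show ?thesis
    unfolding e_def[symmetric]
  proof (intro iffI ballI impI)
    fix v p assume eP: "product_of_primes_in P e" and v: "v \<in> carrier F" and p: "p \<in> perp P"
      and vp: "v [^] p \<in> generate F {w}"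
    have prime: "prime p" and "p \<notin> P" using p by (auto simp: perp_def)
    then have "\<not> p dvd e" using eP product_of_primes_in_iff[OF P] by blast
    obtain j :: int where j: "v [^] p = u [^] (int e * j)" using vp gen by auto
    show "v \<in> generate F {w}"
    proof (cases "j = 0")
      case True
      then have "v [^] p = \<one> [^] p" using j by simp
      then have "v = \<one>" using nat_pow_inj v prime prime_gt_0_nat by blast
      then show ?thesis by (simp add: generate.one)
    next
      case False
      text \<open>Conjugation by \<open>v\<close> fixes a nontrivial power of \<open>u\<close>, hence \<open>u\<close> itself, as roots are unique.\<close>
      have vu: "v \<otimes> u [^] (int e * j) \<otimes> inv v = u [^] (int e * j)"
      proof -
        have "v \<otimes> v [^] p = v [^] p \<otimes> v"
          using v nat_pow_Suc2 nat_pow_Suc by metis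
        then show ?thesis using v u j by (simp add: m_assoc)
      qed
      have inj: "x = y" if xy: "x \<in> carrier F" "y \<in> carrier F" "x [^] i = y [^] i" "i \<noteq> 0"
        for x y and i :: int
      proof -
        have "x [^] nat \<bar>i\<bar> = y [^] nat \<bar>i\<bar>"
          using xy by (cases i rule: int_cases2) (auto simp: int_pow_int int_pow_neg)
        then show ?thesis using nat_pow_inj[of x y "nat \<bar>i\<bar>"] xy by simp
      qed
      have "v \<otimes> u \<otimes> inv v = u"
      proof (rule inj)
        show "(v \<otimes> u \<otimes> inv v) [^] (int e * j) = u [^] (int e * j)"
          using vu int_pow_conj[OF v u] by simp
      qed (use False e u v in auto)
      then have "u \<otimes> v = v \<otimes> u" using u v by (metis inv_solve_right m_closed)
      then obtain k :: int where k: "v = u [^] k"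
        using commute_root_of[OF w v] by (auto simp: u_def)
      then have "u [^] (k * int p) = u [^] (int e * j)"
        using j u by (simp add: int_pow_pow flip: int_pow_int)
      then have kp: "k * int p = int e * j" using int_pow_cancel[OF u u1] by blast
      then have "int p dvd int e * j" by (metis dvd_triv_right)
      then have "int p dvd j"
        using \<open>\<not> p dvd e\<close> prime by (auto simp: prime_dvd_mult_iff)
      then obtain i where "j = int p * i" by blast
      then have "k = int e * i" using kp prime_gt_0_nat[OF prime] by simp
      then show ?thesis using k gen by blast
    qed
  next
    assume closed: "\<forall>v\<in>carrier F. \<forall>p\<in>perp P. v [^] p \<in> generate F {w} \<longrightarrow> v \<in> generate F {w}"
    have "p \<in> P" if p: "prime p" "p dvd e" for p
    proof (rule ccontr)
      assume "p \<notin> P"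
      have "u [^] (e div p) \<in> generate F {w}"
      proof (rule closed[rule_format])
        show "p \<in> perp P" using p \<open>p \<notin> P\<close> by (simp add: perp_def)
        show "(u [^] (e div p)) [^] p \<in> generate F {w}"
          using u p(2) by (simp add: nat_pow_pow wu generate.incl)
      qed (use u in simp)
      then obtain j :: int where "u [^] int (e div p) = u [^] (int e * j)"
        unfolding gen by (auto simp: int_pow_int)
      then have "int (e div p) = int e * j" using int_pow_cancel[OF u u1] by blast
      then have "e dvd e div p" by (metis dvd_triv_left int_dvd_int_iff)
      moreover have "e div p > 0" "e div p < e"
        using e p prime_gt_1_nat[OF p(1)] by (auto simp: div_greater_zero_iff dvd_imp_le)
      ultimately show False by (auto dest: dvd_imp_le)
    qed
    then show "product_of_primes_in P e"
      using e product_of_primes_in_iff[OF P] by blast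
  qed
qed

text \<open>Closed means equal to the closure, here generated by \<open>u [^] nu P e\<close>. As
  \<open>u\<close> has infinite order, equality forces \<open>e\<close> to divide
  \<open>nu P e\<close>, that is, \<open>nu P e = e\<close>.\<close>

lemma closedin_generate_iff:
  assumes w: "w \<in> carrier F" "w \<noteq> \<one>" and P: "P \<noteq> {}" "\<forall>p\<in>P. prime p"
  shows "closedin (pro_topology (GP P) F) (generate F {w}) \<longleftrightarrow>
    product_of_primes_in P (exponent_of F w)"
proof -
  define u e where "u = root_of F w" and "e = exponent_of F w"
  have u: "u \<in> carrier F" and e: "e > 0" and wu: "w = u [^] e"
    using exponent_of_root_of(1-3)[OF w] by (simp_all add: u_def e_def)
  have u1: "u \<noteq> \<one>" using w wu by auto
  have closure: "pro_topology (GP P) F closure_of generate F {w} = generate F {u [^] nu P e}"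
    using closure_of_generate[OF w P] by (simp add: u_def e_def)
  have sub: "generate F {w} \<subseteq> topspace (pro_topology (GP P) F)"
    using generate_incl[of "{w}"] w by (simp add: topspace_pro_topology_GP)
  show ?thesis
    unfolding e_def[symmetric]
  proof
    assume "product_of_primes_in P e"
    then have "nu P e = e" using nu_eq_iff[OF P(2) e] by simp
    then show "closedin (pro_topology (GP P) F) (generate F {w})"
      using closure wu by (metis closedin_closure_of)
  next
    assume "closedin (pro_topology (GP P) F) (generate F {w})"
    then have "generate F {w} = generate F {u [^] nu P e}"
      using closure closure_of_closedin by metis
    then have "u [^] nu P e \<in> generate F {w}"
      using generate.incl by (metis singletonI)
    then obtain j :: int where "u [^] nu P e = w [^] j"
      using generate_pow[OF w(1)] by auto
    then have "u [^] int (nu P e) = u [^] (int e * j)"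
      using u by (simp add: wu int_pow_pow flip: int_pow_int)
    then have "int (nu P e) = int e * j" using int_pow_cancel[OF u u1] by blast
    then have "e dvd nu P e" by (metis dvd_triv_left int_dvd_int_iff)
    then have "nu P e = e" using nu_properties(1)[OF P(2) e] dvd_antisym by blast
    then show "product_of_primes_in P e" using nu_eq_iff[OF P(2) e] by simp
  qed
qed

text \<open>A single prime \<open>q\<close> of \<open>P\<close> suffices: finite
  \<open>q\<close>-groups separate every nontrivial \<open>g\<close> from
  \<open>\<one>\<close>.\<close>

lemma closure_of_generate_one:
  assumes P: "P \<noteq> {}" "\<forall>p\<in>P. prime p"
  shows "pro_topology (GP P) F closure_of generate F {\<one>} = generate F {\<one>}"
proof -
  have "closedin (pro_topology (GP P) F) {\<one>}"
  proof (rule closedin_pro_topology_GP)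
    fix g assume g: "g \<in> carrier F - {\<one>}"
    obtain q where q: "q \<in> P" "prime q" using P by blast
    then obtain H :: "(nat \<Rightarrow> nat \<Rightarrow> int) monoid" and h where
      H: "H \<in> GP {q}" and h: "h \<in> hom F H" and ne: "h g \<noteq> \<one>\<^bsub>H\<^esub>"
      using residually_GP[OF q(2), of g] g by blast
    interpret H: group H using H by (simp add: GP_def)
    have "h g \<notin> h ` {\<one>}"
      using ne hom_one[OF h group_axioms H.group_axioms] by simp
    moreover have "H \<in> GP P" using H q(1) GP_mono[of "{q}" P] by blast
    ultimately show "\<exists>(H :: (nat \<Rightarrow> nat \<Rightarrow> int) monoid) h. H \<in> GP P \<and> h \<in> hom F H \<and> h g \<notin> h ` {\<one>}"
      using h by blast
  qed simp
  then show ?thesis by (simp add: generate_one closure_of_closedin)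
qed

end

theorem corollary3p5:
  fixes F :: "('a, 'b) monoid_scheme" and P :: "nat set"
  assumes "P \<noteq> {}" and "\<forall>p\<in>P. prime p" and "is_free_group F"
  shows "(pro_topology (GP P) F) closure_of (generate F {\<one>\<^bsub>F\<^esub>}) = generate F {\<one>\<^bsub>F\<^esub>} \<and>
    (\<forall>w u e. w \<in> carrier F - {\<one>\<^bsub>F\<^esub>} \<and> u = root_of F w \<and> e = exponent_of F w \<longrightarrow>
       (closedin (pro_topology (GP P) F) (generate F {w}) \<longleftrightarrow> product_of_primes_in P e) \<and>
       (product_of_primes_in P e \<longleftrightarrow>
          (\<forall>v\<in>carrier F. \<forall>p\<in>perp P.
             v [^]\<^bsub>F\<^esub> p \<in> generate F {w} \<longrightarrow> v \<in> generate F {w})) \<and>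
       (pro_topology (GP P) F) closure_of (generate F {w}) = generate F {u [^]\<^bsub>F\<^esub> nu P e})"
proof -
  interpret free_like_group F by (rule is_free_group_imp_free_like_group) fact
  show ?thesis
    using closure_of_generate_one[OF assms(1,2)] closedin_generate_iff[OF _ _ assms(1,2)]
      product_of_primes_exponent_iff[OF _ _ assms(2)] closure_of_generate[OF _ _ assms(1,2)]
    by simp
qed

end
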